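(* Let $n\in\mathbb{N}$. Define $$V_n=\{f:(-1,1)\to\mathbb{C}\mid f\in AC_{\mathrm{loc}}^{(n-1)}(-1,1);\ (1-x^2)^{j/2}f^{(j)}\in L^2(-1,1)\ \ (j=0,1,\ldots,n)\}$$ and $$V_n'=\{f:(-1,1)\to\mathbb{C}\mid f\in AC_{\mathrm{loc}}^{(n-1)}(-1,1);\ (1-x^2)^{n/2}f^{(n)}\in L^2(-1,1)\}.$$ Then $V_n=V_n'$.
   Context: $\mathbb{N}$ denotes the positive integers. $L^2(-1,1)$ is the space of complex-valued Lebesgue square-integrable functions on $(-1,1)$. For an integer $m\ge 0$, $AC_{\mathrm{loc}}^{(m)}(-1,1)$ is the set of functions $f:(-1,1)\to\mathbb{C}$ such that $f,f',\ldots,f^{(m)}$ are absolutely continuous on every compact subinterval of $(-1,1)$ (so $f^{(m+1)}$ exists almost everywhere); for $m=0$ this is just local absolute continuity of $f$. *)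

theory Defs
  imports "HOL-Analysis.Analysis"
begin

text \<open>
  A function on an open interval (a,b) is represented by an element of
  \<^term>\<open>extensional {a<..<b}\<close>. All derivatives below are two-sided and taken at interior
  points, so they do not depend on the value \<^term>\<open>undefined\<close> assigned outside (a,b).
\<close>

definition abs_continuous_on_Icc ::
    "(real \<Rightarrow> 'a::real_normed_vector) \<Rightarrow> real \<Rightarrow> real \<Rightarrow> bool" where
  "abs_continuous_on_Icc f a b \<longleftrightarrow>
     (\<forall>\<epsilon>>0. \<exists>\<delta>>0. \<forall>I :: (real \<times> real) set.
        finite I \<and> (\<forall>(u, v)\<in>I. a \<le> u \<and> u < v \<and> v \<le> b) \<and>
        disjoint_family_on (\<lambda>(u, v). {u<..<v}) I \<and>
        (\<Sum>(u, v)\<in>I. v - u) < \<delta> \<longrightarrow>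
        (\<Sum>(u, v)\<in>I. norm (f v - f u)) < \<epsilon>)"

text \<open>The value at a point where the derivative of order \<open>j\<close> fails to exist is arbitrary.\<close>

definition nth_deriv :: "nat \<Rightarrow> (real \<Rightarrow> 'a::real_normed_vector) \<Rightarrow> real \<Rightarrow> 'a" where
  "nth_deriv j f = ((\<lambda>g x. vector_derivative g (at x)) ^^ j) f"

text \<open>
  The differentiability conjunct says that the derivatives of order up to \<open>m\<close> exist at every
  point of (a,b); the one of order \<open>m + 1\<close> is then only guaranteed almost everywhere.
\<close>

definition AC_loc :: "nat \<Rightarrow> real \<Rightarrow> real \<Rightarrow> (real \<Rightarrow> complex) set" where
  "AC_loc m a b =
     {f \<in> extensional {a<..<b}.
        (\<forall>j<m. \<forall>x\<in>{a<..<b}. nth_deriv j f differentiable at x) \<and>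
        (\<forall>j\<le>m. \<forall>c d. a < c \<and> c \<le> d \<and> d < b \<longrightarrow> abs_continuous_on_Icc (nth_deriv j f) c d)}"

definition square_integrable_on :: "(real \<Rightarrow> complex) \<Rightarrow> real set \<Rightarrow> bool" where
  "square_integrable_on f S \<longleftrightarrow>
     f \<in> borel_measurable (lebesgue_on S) \<and>
     integrable (lebesgue_on S) (\<lambda>x. (cmod (f x))\<^sup>2)"

definition weighted_deriv :: "nat \<Rightarrow> (real \<Rightarrow> complex) \<Rightarrow> real \<Rightarrow> complex" where
  "weighted_deriv j f x = complex_of_real ((1 - x\<^sup>2) powr (real j / 2)) * nth_deriv j f x"

definition V :: "nat \<Rightarrow> (real \<Rightarrow> complex) set" where
  "V n = {f \<in> AC_loc (n - 1) (-1) 1.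
            \<forall>j\<le>n. square_integrable_on (weighted_deriv j f) {-1<..<1}}"

definition V' :: "nat \<Rightarrow> (real \<Rightarrow> complex) set" where
  "V' n = {f \<in> AC_loc (n - 1) (-1) 1.
             square_integrable_on (weighted_deriv n f) {-1<..<1}}"

end

theory Submission
  imports Defs
begin

text \<open>
  Only the passage from the weighted derivative of order \<open>n\<close> to those of lower order needs a
  proof, and it suffices to descend by one order. So let \<open>g = f\<^sup>(\<^sup>j\<^sup>)\<close> with \<open>j < n\<close>, which is locally
  absolutely continuous on \<open>(-1,1)\<close>, put \<open>w(x) = 1 - x\<^sup>2\<close>, and suppose that \<open>w\<^sup>j\<^sup>+\<^sup>1 |g'|\<^sup>2\<close> is
  integrable. The Cauchy--Schwarz inequality gives
  \<open>|g(x) - g(0)|\<^sup>2 \<le> 2 \<integral> |g'(t)|\<^sup>2 dt\<close>, integrated over \<open>t\<close> between \<open>0\<close> and \<open>x\<close>. Multiply by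
  \<open>w(x)\<^sup>j\<close>, integrate over \<open>x\<close> and exchange the integrals: \<open>|g'(t)|\<^sup>2\<close> is then multiplied by the
  integral of \<open>w(x)\<^sup>j\<close> over certain \<open>x\<close> with \<open>|t| \<le> |x| < 1\<close>. There \<open>w(x) \<le> w(t)\<close>, and the set of
  these \<open>x\<close> has measure at most \<open>2(1 - |t|) \<le> 2 w(t)\<close>, so the factor is at most \<open>2 w(t)\<^sup>j\<^sup>+\<^sup>1\<close>. Passing from
  \<open>|g'|\<^sup>2\<close> to \<open>|g - g(0)|\<^sup>2\<close> thus costs one power of the weight, and the constant \<open>g(0)\<close> is
  harmless because \<open>w\<^sup>j\<close> is bounded. This is lemma \<open>weighted_hardy_step\<close>.

  The measure-theoretic input is Lebesgue's theorem that an absolutely continuous function is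
  differentiable almost everywhere and that its increments are integrals of its derivative
  (lemma \<open>abs_continuous_norm_diff_le\<close>). It cannot be bypassed: at a point without derivative the
  value of \<open>vector_derivative\<close> carries no information about \<open>g\<close>. The variation function of \<open>g\<close> is
  absolutely continuous and increasing, which writes the real and imaginary parts of \<open>g\<close> as
  differences of increasing absolutely continuous functions. The Stieltjes measure of such a function
  is absolutely continuous with respect to Lebesgue measure, so the Radon--Nikodym theorem turns the
  function into an indefinite integral, and an indefinite integral has its integrand as derivative at
  almost every point.
\<close>

section \<open>Absolute continuity and variation\<close>

text \<open>
  With an arbitrary index set and degenerate intervals admitted, a family can be cut at a point or
  clamped to a subinterval without changing the index set. A set of pairs with strict inequalities
  would have to be thinned out after each such operation.
\<close>

definition nonoverlapping :: "'i set \<Rightarrow> ('i \<Rightarrow> real) \<Rightarrow> ('i \<Rightarrow> real) \<Rightarrow> real \<Rightarrow> real \<Rightarrow> bool" where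
  "nonoverlapping J u v a b \<longleftrightarrow>
     finite J \<and> (\<forall>j\<in>J. a \<le> u j \<and> u j \<le> v j \<and> v j \<le> b) \<and>
     disjoint_family_on (\<lambda>j. {u j<..<v j}) J"

text \<open>
  Dropping the degenerate intervals changes neither sum. The remaining intervals are nonempty and
  pairwise disjoint, hence pairwise different, so passing to the set of their endpoint pairs loses
  nothing.
\<close>

lemma nonoverlapping_as_pairs:
  fixes g :: "real \<Rightarrow> 'a::real_normed_vector"
  assumes "nonoverlapping J u v a b"
  defines "I \<equiv> (\<lambda>j. (u j, v j)) ` {j\<in>J. u j < v j}"
  shows "finite I" "\<forall>(x, y)\<in>I. a \<le> x \<and> x < y \<and> y \<le> b"
    "disjoint_family_on (\<lambda>(x, y). {x<..<y}) I"
    "(\<Sum>(x, y)\<in>I. y - x) = (\<Sum>j\<in>J. v j - u j)"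
    "(\<Sum>(x, y)\<in>I. norm (g y - g x)) = (\<Sum>j\<in>J. norm (g (v j) - g (u j)))"
proof -
  let ?K = "{j\<in>J. u j < v j}"
  have fin: "finite J" and bd: "\<And>j. j \<in> J \<Longrightarrow> a \<le> u j \<and> u j \<le> v j \<and> v j \<le> b"
    and dj: "\<And>i j. i \<in> J \<Longrightarrow> j \<in> J \<Longrightarrow> i \<noteq> j \<Longrightarrow> {u i<..<v i} \<inter> {u j<..<v j} = {}"
    using assms(1) by (auto simp: nonoverlapping_def disjoint_family_on_def)
  have inj: "inj_on (\<lambda>j. (u j, v j)) ?K"
  proof (rule inj_onI)
    fix i j assume ij: "i \<in> ?K" "j \<in> ?K" "(u i, v i) = (u j, v j)"
    then have "(u i + v i) / 2 \<in> {u i<..<v i} \<inter> {u j<..<v j}" by auto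
    then show "i = j" using dj ij by blast
  qed
  show "finite I" using fin by (simp add: I_def)
  show "\<forall>(x, y)\<in>I. a \<le> x \<and> x < y \<and> y \<le> b" using bd by (auto simp: I_def)
  show "disjoint_family_on (\<lambda>(x, y). {x<..<y}) I"
    unfolding disjoint_family_on_def
  proof (intro ballI impI)
    fix p q assume "p \<in> I" "q \<in> I" "p \<noteq> q"
    then obtain i j where "i \<in> J" "j \<in> J" "p = (u i, v i)" "q = (u j, v j)" "i \<noteq> j"
      by (auto simp: I_def)
    with dj[of i j]
    show "(case p of (x, y) \<Rightarrow> {x<..<y}) \<inter> (case q of (x, y) \<Rightarrow> {x<..<y}) = {}" by simp
  qed
  have restr: "(\<Sum>j\<in>?K. h j) = (\<Sum>j\<in>J. h j)"
    if "\<And>j. u j = v j \<Longrightarrow> h j = 0" for h :: "'b \<Rightarrow> real"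
  proof (rule sum.mono_neutral_left)
    show "\<forall>i\<in>J - ?K. h i = 0" using bd that by force
  qed (use fin in auto)
  show "(\<Sum>(x, y)\<in>I. y - x) = (\<Sum>j\<in>J. v j - u j)"
    unfolding I_def by (subst sum.reindex[OF inj]) (auto intro!: restr)
  show "(\<Sum>(x, y)\<in>I. norm (g y - g x)) = (\<Sum>j\<in>J. norm (g (v j) - g (u j)))"
    unfolding I_def by (subst sum.reindex[OF inj]) (auto intro!: restr)
qed

text \<open>
  Transfers the definition of absolute continuity from sets of pairs to indexed families, in the form
  in which all later proofs use it.
\<close>

lemma abs_continuous_nonoverlapping:
  fixes g :: "real \<Rightarrow> 'a::real_normed_vector"
  assumes "abs_continuous_on_Icc g a b" "\<epsilon> > 0"
  obtains \<delta> where "\<delta> > 0"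
    "\<And>(J :: 'i set) u v. nonoverlapping J u v a b \<Longrightarrow> (\<Sum>j\<in>J. v j - u j) < \<delta> \<Longrightarrow>
       (\<Sum>j\<in>J. norm (g (v j) - g (u j))) < \<epsilon>"
proof -
  obtain \<delta> where \<delta>: "\<delta> > 0" and
    ac: "\<And>I. finite I \<and> (\<forall>(u, v)\<in>I. a \<le> u \<and> u < v \<and> v \<le> b) \<and>
        disjoint_family_on (\<lambda>(u, v). {u<..<v}) I \<and>
        (\<Sum>(u, v)\<in>I. v - u) < \<delta> \<Longrightarrow> (\<Sum>(u, v)\<in>I. norm (g v - g u)) < \<epsilon>"
    using assms unfolding abs_continuous_on_Icc_def by blast
  show thesis
  proof (rule that[OF \<delta>])
    fix J :: "'i set" and u v
    assume J: "nonoverlapping J u v a b" "(\<Sum>j\<in>J. v j - u j) < \<delta>"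
    note P = nonoverlapping_as_pairs[OF J(1)]
    show "(\<Sum>j\<in>J. norm (g (v j) - g (u j))) < \<epsilon>"
      unfolding P(5)[symmetric] by (rule ac) (use P(1-4) J(2) in simp)
  qed
qed

lemma abs_continuousI_nonoverlapping:
  fixes g :: "real \<Rightarrow> 'a::real_normed_vector"
  assumes "\<And>\<epsilon>. \<epsilon> > 0 \<Longrightarrow> \<exists>\<delta>>0. \<forall>(J :: (real \<times> real) set) u v. nonoverlapping J u v a b \<longrightarrow>
     (\<Sum>j\<in>J. v j - u j) < \<delta> \<longrightarrow> (\<Sum>j\<in>J. norm (g (v j) - g (u j))) < \<epsilon>"
  shows "abs_continuous_on_Icc g a b"
  unfolding abs_continuous_on_Icc_def
proof (intro allI impI)
  fix \<epsilon> :: real assume "\<epsilon> > 0"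
  then obtain \<delta> where \<delta>: "\<delta> > 0" and *: "\<And>(J :: (real \<times> real) set) u v. nonoverlapping J u v a b \<Longrightarrow>
     (\<Sum>j\<in>J. v j - u j) < \<delta> \<Longrightarrow> (\<Sum>j\<in>J. norm (g (v j) - g (u j))) < \<epsilon>"
    using assms by meson
  show "\<exists>\<delta>>0. \<forall>I. finite I \<and> (\<forall>(u, v)\<in>I. a \<le> u \<and> u < v \<and> v \<le> b) \<and>
        disjoint_family_on (\<lambda>(u, v). {u<..<v}) I \<and>
        (\<Sum>(u, v)\<in>I. v - u) < \<delta> \<longrightarrow> (\<Sum>(u, v)\<in>I. norm (g v - g u)) < \<epsilon>"
  proof (intro exI[of _ \<delta>] conjI \<delta> allI impI; elim conjE)
    fix I assume "finite I" "\<forall>(u, v)\<in>I. a \<le> u \<and> u < v \<and> v \<le> b"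
      "disjoint_family_on (\<lambda>(u, v). {u<..<v}) I" "(\<Sum>(u, v)\<in>I. v - u) < \<delta>"
    then show "(\<Sum>(u, v)\<in>I. norm (g v - g u)) < \<epsilon>"
      using *[of I fst snd] by (fastforce simp: nonoverlapping_def case_prod_beta')
  qed
qed

lemma nonoverlapping_length_le:
  assumes "nonoverlapping J u v a b" "a \<le> b"
  shows "(\<Sum>j\<in>J. v j - u j) \<le> b - a"
proof -
  have fin: "finite J" and bd: "\<And>j. j \<in> J \<Longrightarrow> a \<le> u j \<and> u j \<le> v j \<and> v j \<le> b"
    and dj: "disjoint_family_on (\<lambda>j. {u j<..<v j}) J"
    using assms(1) by (auto simp: nonoverlapping_def)
  have "(\<Sum>j\<in>J. v j - u j) = (\<Sum>j\<in>J. measure lborel {u j<..<v j})"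
    using bd by (intro sum.cong) auto
  also have "\<dots> = measure lborel (\<Union>j\<in>J. {u j<..<v j})"
    using fin dj bd by (intro measure_finite_Union[symmetric]) (auto simp: emeasure_lborel_box_eq)
  also have "\<dots> \<le> measure lborel {a..b}"
  proof (rule measure_mono_fmeasurable)
    show "(\<Union>j\<in>J. {u j<..<v j}) \<subseteq> {a..b}" using bd by force
    show "(\<Union>j\<in>J. {u j<..<v j}) \<in> sets lborel" using fin by auto
    show "{a..b} \<in> fmeasurable lborel" using assms(2) by (simp add: fmeasurable_def)
  qed
  also have "\<dots> = b - a" using assms(2) by simp
  finally show ?thesis .
qed

definition variation :: "(real \<Rightarrow> 'a::real_normed_vector) \<Rightarrow> real \<Rightarrow> real \<Rightarrow> real" where
  "variation g a b = Sup {(\<Sum>(x, y)\<in>I. norm (g y - g x)) | I. nonoverlapping I fst snd a b}"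

definition bounded_variation :: "(real \<Rightarrow> 'a::real_normed_vector) \<Rightarrow> real \<Rightarrow> real \<Rightarrow> bool" where
  "bounded_variation g a b \<longleftrightarrow>
     bdd_above {(\<Sum>(x, y)\<in>I. norm (g y - g x)) | I. nonoverlapping I fst snd a b}"

lemma nonoverlapping_empty [simp]: "nonoverlapping {} u v a b"
  by (simp add: nonoverlapping_def disjoint_family_on_def)

lemma nonoverlapping_image_pairs:
  fixes g :: "real \<Rightarrow> 'a::real_normed_vector"
  assumes "nonoverlapping J u v a b"
  obtains I where "nonoverlapping I fst snd a b"
    "(\<Sum>(x, y)\<in>I. norm (g y - g x)) = (\<Sum>j\<in>J. norm (g (v j) - g (u j)))"
proof
  note P = nonoverlapping_as_pairs[OF assms]
  show "nonoverlapping ((\<lambda>j. (u j, v j)) ` {j\<in>J. u j < v j}) fst snd a b"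
    using P(1-3) by (fastforce simp: nonoverlapping_def case_prod_beta')
qed (rule nonoverlapping_as_pairs[OF assms])

lemma variation_upper:
  assumes "bounded_variation g a b" "nonoverlapping J u v a b"
  shows "(\<Sum>j\<in>J. norm (g (v j) - g (u j))) \<le> variation g a b"
proof -
  obtain I where "nonoverlapping I fst snd a b"
    "(\<Sum>(x, y)\<in>I. norm (g y - g x)) = (\<Sum>j\<in>J. norm (g (v j) - g (u j)))"
    by (rule nonoverlapping_image_pairs[OF assms(2)])
  then show ?thesis
    using assms(1) unfolding variation_def bounded_variation_def
    by (intro cSup_upper) (auto intro: sym)
qed

lemma variation_least:
  assumes "\<And>I. nonoverlapping I fst snd a b \<Longrightarrow> (\<Sum>(x, y)\<in>I. norm (g y - g x)) \<le> B"
  shows "variation g a b \<le> B"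
  unfolding variation_def using assms
  by (intro cSup_least) (auto intro!: exI[of _ "{}"])

lemma bounded_variationI:
  assumes "\<And>I. nonoverlapping I fst snd a b \<Longrightarrow> (\<Sum>(x, y)\<in>I. norm (g y - g x)) \<le> B"
  shows "bounded_variation g a b"
  unfolding bounded_variation_def using assms by (intro bdd_aboveI[of _ B]) auto

lemma nonoverlapping_subinterval:
  assumes "nonoverlapping J u v c d" "a \<le> c" "d \<le> b"
  shows "nonoverlapping J u v a b"
  using assms by (force simp: nonoverlapping_def)

lemma bounded_variation_subinterval:
  assumes "bounded_variation g a b" "a \<le> c" "d \<le> b"
  shows "bounded_variation g c d"
proof (rule bounded_variationI)
  fix I assume "nonoverlapping I fst snd c d"
  from variation_upper[OF assms(1) nonoverlapping_subinterval[OF this assms(2,3)]]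
  show "(\<Sum>(x, y)\<in>I. norm (g y - g x)) \<le> variation g a b"
    by (simp add: case_prod_beta')
qed

lemma nonoverlapping_clamp:
  assumes "nonoverlapping J u v a b" "c \<le> d"
  shows "nonoverlapping J (\<lambda>j. max c (min d (u j))) (\<lambda>j. max c (min d (v j))) c d"
proof -
  have sub: "{max c (min d (u j))<..<max c (min d (v j))} \<subseteq> {u j<..<v j}" for j
    by auto
  have "{max c (min d (u i))<..<max c (min d (v i))} \<inter> {max c (min d (u j))<..<max c (min d (v j))} = {}"
    if "i \<in> J" "j \<in> J" "i \<noteq> j" for i j
  proof -
    have "{u i<..<v i} \<inter> {u j<..<v j} = {}"
      using assms(1) that unfolding nonoverlapping_def disjoint_family_on_def by blast
    then show ?thesis using sub[of i] sub[of j] by blast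
  qed
  moreover have "max c (min d (u j)) \<le> max c (min d (v j))" if "j \<in> J" for j
    using assms that by (auto simp: nonoverlapping_def max_def min_def)
  ultimately show ?thesis
    using assms by (simp add: nonoverlapping_def disjoint_family_on_def)
qed

text \<open>
  The refinement of a family: each interval of \<open>J\<close> is replaced by a family inside it. Disjointness
  comes from the inner family or from the outer one, depending on whether the two intervals lie in the
  same interval of \<open>J\<close>.
\<close>

lemma nonoverlapping_Sigma:
  assumes J: "nonoverlapping J u v a b"
    and K: "\<And>j. j \<in> J \<Longrightarrow> nonoverlapping (K j) (s j) (t j) (u j) (v j)"
  shows "nonoverlapping (Sigma J K) (\<lambda>(j, k). s j k) (\<lambda>(j, k). t j k) a b"
proof -
  have bd: "a \<le> u j \<and> v j \<le> b" if "j \<in> J" for j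
    using J that by (auto simp: nonoverlapping_def)
  have bd': "u j \<le> s j k \<and> s j k \<le> t j k \<and> t j k \<le> v j" if "j \<in> J" "k \<in> K j" for j k
    using K that by (auto simp: nonoverlapping_def)
  have sub: "{s j k<..<t j k} \<subseteq> {u j<..<v j}" if "j \<in> J" "k \<in> K j" for j k
    using bd'[OF that] by auto
  have dj: "{s i k<..<t i k} \<inter> {s j l<..<t j l} = {}"
    if "i \<in> J" "k \<in> K i" "j \<in> J" "l \<in> K j" "i = j \<longrightarrow> k \<noteq> l" for i j k l
  proof (cases "i = j")
    case True
    then show ?thesis using K[of i] that unfolding nonoverlapping_def disjoint_family_on_def by blast
  next
    case False
    then have "{u i<..<v i} \<inter> {u j<..<v j} = {}"
      using J that unfolding nonoverlapping_def disjoint_family_on_def by blast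
    then show ?thesis using sub that by blast
  qed
  have "finite (Sigma J K)" using J K by (auto simp: nonoverlapping_def)
  moreover have "\<forall>p\<in>Sigma J K. a \<le> (\<lambda>(j, k). s j k) p \<and> (\<lambda>(j, k). s j k) p \<le> (\<lambda>(j, k). t j k) p \<and>
      (\<lambda>(j, k). t j k) p \<le> b"
    using bd bd' by force
  moreover have "disjoint_family_on (\<lambda>p. {(\<lambda>(j, k). s j k) p<..<(\<lambda>(j, k). t j k) p}) (Sigma J K)"
    unfolding disjoint_family_on_def using dj by auto
  ultimately show ?thesis by (simp add: nonoverlapping_def)
qed

text \<open>
  Cutting a family at \<open>c\<close> amounts to clamping it to each of the two halves; the triangle inequality is
  used only for the interval that contains \<open>c\<close>, and every other interval becomes degenerate in one
  half.
\<close>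

lemma sum_norm_split:
  fixes g :: "real \<Rightarrow> 'a::real_normed_vector"
  assumes "nonoverlapping J u v a b" "a \<le> c" "c \<le> b"
  shows "(\<Sum>j\<in>J. norm (g (v j) - g (u j))) \<le>
    (\<Sum>j\<in>J. norm (g (max a (min c (v j))) - g (max a (min c (u j))))) +
    (\<Sum>j\<in>J. norm (g (max c (min b (v j))) - g (max c (min b (u j)))))"
  unfolding sum.distrib[symmetric]
proof (rule sum_mono)
  fix j assume "j \<in> J"
  then have "a \<le> u j" "u j \<le> v j" "v j \<le> b" using assms by (auto simp: nonoverlapping_def)
  moreover have "norm (g y - g x) \<le> norm (g c - g x) + norm (g y - g c)" for x y
    using norm_triangle_ineq[of "g c - g x" "g y - g c"] by simp
  ultimately show "norm (g (v j) - g (u j)) \<le> norm (g (max a (min c (v j))) - g (max a (min c (u j)))) +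
      norm (g (max c (min b (v j))) - g (max c (min b (u j))))"
    using assms(2,3) by (simp add: max_def min_def)
qed

lemma bounded_variation_combine:
  assumes "bounded_variation g a c" "bounded_variation g c b" "a \<le> c" "c \<le> b"
  shows "bounded_variation g a b" "variation g a b \<le> variation g a c + variation g c b"
proof -
  have *: "(\<Sum>(x, y)\<in>I. norm (g y - g x)) \<le> variation g a c + variation g c b"
    if "nonoverlapping I fst snd a b" for I
    unfolding case_prod_beta'
    by (rule order_trans[OF sum_norm_split[OF that assms(3,4)]] add_mono
          variation_upper assms nonoverlapping_clamp that)+
  show "bounded_variation g a b" using bounded_variationI * .
  show "variation g a b \<le> variation g a c + variation g c b" using variation_least * .
qed

text \<open>
  Absolute continuity with \<open>\<epsilon> = 1\<close> bounds the variation on every interval shorter than \<open>\<delta>\<close> by \<open>1\<close>,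
  and finitely many of these cover \<open>[a,b]\<close>.
\<close>

lemma abs_continuous_bounded_variation:
  assumes ac: "abs_continuous_on_Icc g a b"
  shows "bounded_variation g a b"
proof -
  obtain \<delta> where \<delta>: "\<delta> > 0" "\<And>(J :: (real \<times> real) set) u v. nonoverlapping J u v a b \<Longrightarrow>
       (\<Sum>j\<in>J. v j - u j) < \<delta> \<Longrightarrow> (\<Sum>j\<in>J. norm (g (v j) - g (u j))) < 1"
    using abs_continuous_nonoverlapping[OF ac zero_less_one] by blast
  have small: "bounded_variation g c d" if "a \<le> c" "c \<le> d" "d \<le> b" "d - c < \<delta>" for c d
  proof (rule bounded_variationI[of _ _ _ 1])
    fix I assume I: "nonoverlapping I fst snd c d"
    from nonoverlapping_length_le[OF I \<open>c \<le> d\<close>] \<open>d - c < \<delta>\<close>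
      \<delta>(2)[OF nonoverlapping_subinterval[OF I \<open>a \<le> c\<close> \<open>d \<le> b\<close>]]
    show "(\<Sum>(x, y)\<in>I. norm (g y - g x)) \<le> 1" by (simp add: case_prod_beta')
  qed
  have step: "bounded_variation g a d" if "a \<le> d" "d \<le> b" "d - a \<le> real n * (\<delta> / 2)" for n d
    using that
  proof (induction n arbitrary: d)
    case 0
    then show ?case using small[of a d] \<delta>(1) by auto
  next
    case (Suc n)
    let ?c = "max a (d - \<delta> / 2)"
    have "bounded_variation g a ?c"
      by (rule Suc.IH) (use Suc.prems \<delta>(1) in \<open>auto simp: field_simps max_def\<close>)
    moreover have "bounded_variation g ?c d"
      by (rule small) (use Suc.prems \<delta>(1) in auto)
    ultimately show ?case
      by (rule bounded_variation_combine) (use Suc.prems \<delta>(1) in auto)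
  qed
  show ?thesis
  proof (cases "a \<le> b")
    case True
    obtain n where "(b - a) / (\<delta> / 2) < real n" using reals_Archimedean2 by blast
    then have "b - a \<le> real n * (\<delta> / 2)" using \<delta>(1) by (simp add: field_simps)
    then show ?thesis using step True by blast
  next
    case False
    show ?thesis
    proof (rule bounded_variationI[of _ _ _ 0])
      fix I assume "nonoverlapping I fst snd a b"
      then have "I = {}" using False by (force simp: nonoverlapping_def)
      then show "(\<Sum>(x, y)\<in>I. norm (g y - g x)) \<le> 0" by simp
    qed
  qed
qed

lemma norm_diff_le_variation:
  assumes "bounded_variation g a b" "a \<le> b"
  shows "norm (g b - g a) \<le> variation g a b"
  using variation_upper[OF assms(1), of "{()}" "\<lambda>_. a" "\<lambda>_. b"] assms(2)
  by (simp add: nonoverlapping_def disjoint_family_on_def)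

text \<open>
  A family in \<open>[a,c]\<close> and one in \<open>[c,b]\<close> together form a family in \<open>[a,b]\<close>; their union is taken as a
  refinement of the two-interval family indexed by \<open>bool\<close>.
\<close>

lemma variation_superadditive:
  assumes bv: "bounded_variation g a b" and "a \<le> c" "c \<le> b"
  shows "variation g a c + variation g c b \<le> variation g a b"
proof -
  have "variation g a c + (\<Sum>(x, y)\<in>I2. norm (g y - g x)) \<le> variation g a b"
    if I2: "nonoverlapping I2 fst snd c b" for I2
  proof -
    have "variation g a c \<le> variation g a b - (\<Sum>(x, y)\<in>I2. norm (g y - g x))"
    proof (rule variation_least)
      fix I1 assume I1: "nonoverlapping I1 fst snd a c"
      have J: "nonoverlapping (UNIV :: bool set) (\<lambda>i. if i then a else c) (\<lambda>i. if i then c else b) a b"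
        using assms by (auto simp: nonoverlapping_def disjoint_family_on_def)
      have "nonoverlapping (Sigma UNIV (\<lambda>i. if i then I1 else I2)) (\<lambda>(j, k). fst k) (\<lambda>(j, k). snd k) a b"
        by (rule nonoverlapping_Sigma[OF J]) (use I1 I2 in auto)
      from variation_upper[OF bv this]
      have "(\<Sum>p\<in>Sigma UNIV (\<lambda>i. if i then I1 else I2). norm (g (snd (snd p)) - g (fst (snd p)))) \<le> variation g a b"
        by (simp add: case_prod_beta')
      also have "(\<Sum>p\<in>Sigma UNIV (\<lambda>i. if i then I1 else I2). norm (g (snd (snd p)) - g (fst (snd p)))) =
         (\<Sum>i\<in>UNIV. \<Sum>k\<in>(if i then I1 else I2). norm (g (snd k) - g (fst k)))"
        by (subst sum.Sigma) (use I1 I2 in \<open>auto simp: nonoverlapping_def case_prod_beta'\<close>)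
      also have "\<dots> = (\<Sum>k\<in>I1. norm (g (snd k) - g (fst k))) + (\<Sum>k\<in>I2. norm (g (snd k) - g (fst k)))"
        by (simp add: UNIV_bool)
      finally show "(\<Sum>(x, y)\<in>I1. norm (g y - g x)) \<le> variation g a b - (\<Sum>(x, y)\<in>I2. norm (g y - g x))"
        by (simp add: case_prod_beta')
    qed
    then show ?thesis by simp
  qed
  then have "variation g c b \<le> variation g a b - variation g a c"
    by (intro variation_least) (simp add: algebra_simps)
  then show ?thesis by simp
qed

lemma variation_additive:
  assumes "bounded_variation g a b" "a \<le> c" "c \<le> b"
  shows "variation g a b = variation g a c + variation g c b"
  using variation_superadditive[OF assms] 
    bounded_variation_combine(2)[OF bounded_variation_subinterval bounded_variation_subinterval, OF assms(1) _ _ assms(1)]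
    assms by fastforce

text \<open>
  By additivity the increment of the variation function over \<open>[u,v]\<close> is the variation over \<open>[u,v]\<close>,
  which some family inside \<open>[u,v]\<close> almost attains. Doing this in every interval of a family \<open>J\<close> gives
  a refinement whose total length is at most that of \<open>J\<close>, so absolute continuity of \<open>g\<close> applies to
  the refinement.
\<close>

lemma abs_continuous_variation:
  assumes ac: "abs_continuous_on_Icc g a b"
  shows "abs_continuous_on_Icc (variation g a) a b"
proof (rule abs_continuousI_nonoverlapping)
  fix \<epsilon> :: real assume "\<epsilon> > 0"
  have bv: "bounded_variation g a b" by (rule abs_continuous_bounded_variation[OF ac])
  obtain \<delta> where \<delta>: "\<delta> > 0" "\<And>(J :: ((real \<times> real) \<times> (real \<times> real)) set) u v. nonoverlapping J u v a b \<Longrightarrow>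
       (\<Sum>j\<in>J. v j - u j) < \<delta> \<Longrightarrow> (\<Sum>j\<in>J. norm (g (v j) - g (u j))) < \<epsilon> / 2"
    using abs_continuous_nonoverlapping[OF ac half_gt_zero[OF \<open>\<epsilon> > 0\<close>]] by blast
  show "\<exists>\<delta>>0. \<forall>(J :: (real \<times> real) set) u v. nonoverlapping J u v a b \<longrightarrow>
     (\<Sum>j\<in>J. v j - u j) < \<delta> \<longrightarrow> (\<Sum>j\<in>J. norm (variation g a (v j) - variation g a (u j))) < \<epsilon>"
  proof (intro exI[of _ \<delta>] conjI \<delta>(1) allI impI)
    fix J :: "(real \<times> real) set" and u v
    assume J: "nonoverlapping J u v a b" and len: "(\<Sum>j\<in>J. v j - u j) < \<delta>"
    have fin: "finite J" and bd: "\<And>j. j \<in> J \<Longrightarrow> a \<le> u j \<and> u j \<le> v j \<and> v j \<le> b"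
      using J by (auto simp: nonoverlapping_def)
    \<comment> \<open>The errors of approximation, one for each interval of \<open>J\<close>, add up to at most \<open>\<epsilon> / 2\<close>.\<close>
    define \<eta> where "\<eta> = \<epsilon> / (2 * (real (card J) + 1))"
    have "\<eta> > 0" using \<open>\<epsilon> > 0\<close> by (simp add: \<eta>_def)
    have "\<exists>I. nonoverlapping I fst snd (u j) (v j) \<and>
        variation g (u j) (v j) \<le> (\<Sum>(x, y)\<in>I. norm (g y - g x)) + \<eta>" for j
    proof (rule ccontr)
      assume *: "\<not> ?thesis"
      have "variation g (u j) (v j) \<le> variation g (u j) (v j) - \<eta>"
        by (rule variation_least) (use * in \<open>force simp: not_le\<close>)
      then show False using \<open>\<eta> > 0\<close> by simp
    qed
    then obtain I where I: "\<And>j. nonoverlapping (I j) fst snd (u j) (v j)" 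
      "\<And>j. variation g (u j) (v j) \<le> (\<Sum>(x, y)\<in>I j. norm (g y - g x)) + \<eta>"
      by metis
    have finI: "finite (I j)" for j using I(1) by (simp add: nonoverlapping_def)
    have S: "nonoverlapping (Sigma J I) (\<lambda>(j, k). fst k) (\<lambda>(j, k). snd k) a b"
      by (rule nonoverlapping_Sigma[OF J I(1)])
    have "(\<Sum>p\<in>Sigma J I. (\<lambda>(j, k). snd k) p - (\<lambda>(j, k). fst k) p) =
        (\<Sum>j\<in>J. \<Sum>k\<in>I j. snd k - fst k)"
      by (subst sum.Sigma) (use fin finI in \<open>auto simp: case_prod_beta'\<close>)
    also have "\<dots> \<le> (\<Sum>j\<in>J. v j - u j)"
      by (intro sum_mono nonoverlapping_length_le I(1)) (use bd in auto)
    also note len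
    finally have "(\<Sum>p\<in>Sigma J I. norm (g ((\<lambda>(j, k). snd k) p) - g ((\<lambda>(j, k). fst k) p))) < \<epsilon> / 2"
      by (rule \<delta>(2)[OF S])
    also have "(\<Sum>p\<in>Sigma J I. norm (g ((\<lambda>(j, k). snd k) p) - g ((\<lambda>(j, k). fst k) p))) =
       (\<Sum>j\<in>J. \<Sum>k\<in>I j. norm (g (snd k) - g (fst k)))"
      by (subst sum.Sigma) (use fin finI in \<open>auto simp: case_prod_beta'\<close>)
    finally have half: "(\<Sum>j\<in>J. \<Sum>k\<in>I j. norm (g (snd k) - g (fst k))) < \<epsilon> / 2" .
    have "norm (variation g a (v j) - variation g a (u j)) \<le> (\<Sum>k\<in>I j. norm (g (snd k) - g (fst k))) + \<eta>"
      if "j \<in> J" for j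
    proof -
      have *: "a \<le> u j" "u j \<le> v j" "v j \<le> b" using bd that by auto
      have "variation g a (v j) = variation g a (u j) + variation g (u j) (v j)"
        by (rule variation_additive[OF bounded_variation_subinterval[OF bv]]) (use * in auto)
      moreover have "0 \<le> variation g (u j) (v j)"
        by (rule order_trans[OF norm_ge_zero norm_diff_le_variation[OF bounded_variation_subinterval[OF bv]]])
          (use * in auto)
      ultimately show ?thesis using I(2)[of j] by (simp add: case_prod_beta')
    qed
    then have "(\<Sum>j\<in>J. norm (variation g a (v j) - variation g a (u j))) \<le>
       (\<Sum>j\<in>J. (\<Sum>k\<in>I j. norm (g (snd k) - g (fst k))) + \<eta>)"
      by (rule sum_mono)
    also have "\<dots> = (\<Sum>j\<in>J. \<Sum>k\<in>I j. norm (g (snd k) - g (fst k))) + real (card J) * \<eta>"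
      by (simp add: sum.distrib)
    also have "\<dots> < \<epsilon> / 2 + \<epsilon> / 2"
    proof (rule add_less_le_mono[OF half])
      show "real (card J) * \<eta> \<le> \<epsilon> / 2"
        using \<open>\<epsilon> > 0\<close> by (simp add: \<eta>_def field_simps)
    qed
    finally show "(\<Sum>j\<in>J. norm (variation g a (v j) - variation g a (u j))) < \<epsilon>" by simp
  qed
qed

text \<open>
  Used with the variation function in the role of \<open>F\<close> to see that the difference between it and the
  real or imaginary part of \<open>g\<close> is absolutely continuous.
\<close>

lemma abs_continuous_on_Icc_dominated:
  fixes g :: "real \<Rightarrow> 'a::real_normed_vector" and F :: "real \<Rightarrow> 'b::real_normed_vector"
  assumes ac: "abs_continuous_on_Icc F a b"
    and le: "\<And>x y. a \<le> x \<Longrightarrow> x \<le> y \<Longrightarrow> y \<le> b \<Longrightarrow> norm (g y - g x) \<le> C * norm (F y - F x)"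
  shows "abs_continuous_on_Icc g a b"
proof (rule abs_continuousI_nonoverlapping)
  fix \<epsilon> :: real assume "\<epsilon> > 0"
  \<comment> \<open>A constant \<open>C \<le> 0\<close> would not leave a positive tolerance \<open>\<epsilon> / C\<close> for \<open>F\<close>.\<close>
  define D where "D = max C 1"
  have "D > 0" by (simp add: D_def)
  obtain \<delta> where \<delta>: "\<delta> > 0" "\<And>(J :: (real \<times> real) set) u v. nonoverlapping J u v a b \<Longrightarrow>
       (\<Sum>j\<in>J. v j - u j) < \<delta> \<Longrightarrow> (\<Sum>j\<in>J. norm (F (v j) - F (u j))) < \<epsilon> / D"
    using abs_continuous_nonoverlapping[OF ac divide_pos_pos[OF \<open>\<epsilon> > 0\<close> \<open>D > 0\<close>]] by blast
  show "\<exists>\<delta>>0. \<forall>(J :: (real \<times> real) set) u v. nonoverlapping J u v a b \<longrightarrow>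
     (\<Sum>j\<in>J. v j - u j) < \<delta> \<longrightarrow> (\<Sum>j\<in>J. norm (g (v j) - g (u j))) < \<epsilon>"
  proof (intro exI[of _ \<delta>] conjI \<delta>(1) allI impI)
    fix J :: "(real \<times> real) set" and u v
    assume J: "nonoverlapping J u v a b" and len: "(\<Sum>j\<in>J. v j - u j) < \<delta>"
    have "(\<Sum>j\<in>J. norm (g (v j) - g (u j))) \<le> (\<Sum>j\<in>J. D * norm (F (v j) - F (u j)))"
    proof (rule sum_mono)
      fix j assume "j \<in> J"
      then have "norm (g (v j) - g (u j)) \<le> C * norm (F (v j) - F (u j))"
        using J by (intro le) (auto simp: nonoverlapping_def)
      also have "\<dots> \<le> D * norm (F (v j) - F (u j))"
        by (rule mult_right_mono) (simp_all add: D_def)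
      finally show "norm (g (v j) - g (u j)) \<le> D * norm (F (v j) - F (u j))" .
    qed
    also have "\<dots> = D * (\<Sum>j\<in>J. norm (F (v j) - F (u j)))" by (simp add: sum_distrib_left)
    also have "\<dots> < \<epsilon>" using \<delta>(2)[OF J len] \<open>D > 0\<close> by (simp add: field_simps)
    finally show "(\<Sum>j\<in>J. norm (g (v j) - g (u j))) < \<epsilon>" .
  qed
qed

lemma abs_continuous_on_Icc_continuous_on:
  assumes ac: "abs_continuous_on_Icc g a b"
  shows "continuous_on {a..b} g"
proof (rule continuous_onI)
  fix x \<epsilon> :: real assume x: "x \<in> {a..b}" and "\<epsilon> > 0"
  obtain \<delta> where \<delta>: "\<delta> > 0" "\<And>(J :: unit set) u v. nonoverlapping J u v a b \<Longrightarrow>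
       (\<Sum>j\<in>J. v j - u j) < \<delta> \<Longrightarrow> (\<Sum>j\<in>J. norm (g (v j) - g (u j))) < \<epsilon>"
    using abs_continuous_nonoverlapping[OF ac \<open>\<epsilon> > 0\<close>] by blast
  show "\<exists>d>0. \<forall>x'\<in>{a..b}. dist x' x < d \<longrightarrow> dist (g x') (g x) \<le> \<epsilon>"
  proof (intro exI[of _ \<delta>] conjI \<delta>(1) ballI impI)
    fix y assume y: "y \<in> {a..b}" "dist y x < \<delta>"
    have "norm (g (max x y) - g (min x y)) < \<epsilon>"
      using \<delta>(2)[of "{()}" "\<lambda>_. min x y" "\<lambda>_. max x y"] x y
      by (auto simp: nonoverlapping_def disjoint_family_on_def dist_real_def)
    then show "dist (g y) (g x) \<le> \<epsilon>"
      by (cases "x \<le> y") (auto simp: dist_norm norm_minus_commute max_def min_def)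
  qed
qed

section \<open>Absolutely continuous functions are indefinite integrals\<close>

lemma open_connected_bounded_real:
  fixes S :: "real set"
  assumes "open S" "connected S" "bounded S" "S \<noteq> {}"
  shows "S = {Inf S<..<Sup S}"
proof (intro equalityI subsetI)
  have bdd: "bdd_above S" "bdd_below S" using assms(3) by (simp_all add: bounded_imp_bdd_above bounded_imp_bdd_below)
  fix x
  {
    assume "x \<in> S"
    then obtain e where "e > 0" "ball x e \<subseteq> S" using \<open>open S\<close> by (meson open_contains_ball)
    moreover have "x - e / 2 \<in> ball x e" "x + e / 2 \<in> ball x e" using \<open>e > 0\<close> by (auto simp: dist_real_def)
    ultimately have "Inf S \<le> x - e / 2" "x + e / 2 \<le> Sup S" using bdd by (auto intro!: cInf_lower cSup_upper)
    then show "x \<in> {Inf S<..<Sup S}" using \<open>e > 0\<close> by auto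
  next
    assume x: "x \<in> {Inf S<..<Sup S}"
    obtain y z where "y \<in> S" "y < x" "z \<in> S" "x < z"
      using x cInf_lessD[OF \<open>S \<noteq> {}\<close>, of x] less_cSupD[OF \<open>S \<noteq> {}\<close>, of x] by auto
    then show "x \<in> S" using connectedD_interval[OF \<open>connected S\<close>, of y z x] by simp
  }
qed

text \<open>
  The connected components of \<open>U\<close> are disjoint open intervals of total length less than \<open>\<delta>\<close>, and the
  Stieltjes measure of such an interval is at most the increment of \<open>G\<close> over it. Absolute continuity
  controls finitely many components at a time; since there are countably many, continuity from below
  gives the bound for \<open>U\<close>.
\<close>

lemma interval_measure_open_le:
  fixes G :: "real \<Rightarrow> real"
  assumes mono: "\<And>x y. x \<le> y \<Longrightarrow> G x \<le> G y" and cont: "\<And>x. continuous (at_right x) G"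
    and U: "open U" "U \<subseteq> {-r<..<r}" "measure lborel U < \<delta>"
    and \<delta>: "\<And>(J :: real set set) u v. nonoverlapping J u v (-r) r \<Longrightarrow> (\<Sum>j\<in>J. v j - u j) < \<delta> \<Longrightarrow>
       (\<Sum>j\<in>J. norm (G (v j) - G (u j))) < \<epsilon>"
  shows "emeasure (interval_measure G) U \<le> ennreal \<epsilon>"
proof -
  let ?C = "components U"
  have comp: "c = {Inf c<..<Sup c}" "open c" "c \<noteq> {}" "c \<subseteq> U" "Inf c < Sup c" "-r \<le> Inf c" "Sup c \<le> r"
    if "c \<in> ?C" for c
  proof -
    show op: "open c" using open_components U(1) that by blast
    show ne: "c \<noteq> {}" using in_components_nonempty that by blast
    show sub: "c \<subseteq> U" using in_components_subset that by blast
    have "bounded c" using sub U(2) bounded_subset[of "{-r<..<r}" c] by auto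
    then show eq: "c = {Inf c<..<Sup c}"
      using open_connected_bounded_real[OF op in_components_connected[OF that] _ ne] by simp
    show "Inf c < Sup c" using eq ne by (metis greaterThanLessThan_empty_iff not_less)
    show "-r \<le> Inf c" "Sup c \<le> r"
      using sub U(2) ne by (force intro!: cInf_greatest cSup_least)+
  qed
  have fin: "emeasure (interval_measure G) (\<Union>K) \<le> ennreal \<epsilon>" if K: "K \<subseteq> ?C" "finite K" for K
  proof -
    have dj: "disjoint_family_on (\<lambda>c. c) K"
      using pairwise_disjoint_components[of U] K(1)
      unfolding disjoint_family_on_def pairwise_def by blast
    have no: "nonoverlapping K Inf Sup (-r) r"
      unfolding nonoverlapping_def
    proof (intro conjI ballI)
      show "disjoint_family_on (\<lambda>j. {Inf j<..<Sup j}) K"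
        using dj comp(1) K(1) unfolding disjoint_family_on_def by (metis subsetD)
    qed (use K comp(6,7) less_imp_le[OF comp(5)] in auto)
    have meas: "emeasure lborel c \<noteq> \<infinity>" "measure lborel c = Sup c - Inf c" "c \<in> sets borel" if "c \<in> K" for c
    proof -
      have c: "c \<in> ?C" using that K by auto
      show "emeasure lborel c \<noteq> \<infinity>" "measure lborel c = Sup c - Inf c"
        by (subst comp(1)[OF c], use comp(5)[OF c] in simp)+
      show "c \<in> sets borel" using comp(2)[OF c] by simp
    qed
    have "(\<Sum>c\<in>K. Sup c - Inf c) = (\<Sum>c\<in>K. measure lborel c)"
      using meas by simp
    also have "\<dots> = measure lborel (\<Union>c\<in>K. c)"
      using meas K dj by (intro measure_finite_Union[symmetric]) auto
    also have "\<dots> \<le> measure lborel U"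
    proof (rule measure_mono_fmeasurable)
      show "(\<Union>c\<in>K. c) \<subseteq> U" using comp(4) K by auto
      show "(\<Union>c\<in>K. c) \<in> sets lborel" using meas(3) K(2) by auto
      have "emeasure lborel U \<le> emeasure lborel {-r<..<r}" using U by (intro emeasure_mono) auto
      also have "\<dots> < \<infinity>" by (rule emeasure_bounded_finite) simp
      finally show "U \<in> fmeasurable lborel" using U(1) by (simp add: fmeasurable_def)
    qed
    also note U(3)
    finally have small: "(\<Sum>c\<in>K. norm (G (Sup c) - G (Inf c))) < \<epsilon>" by (rule \<delta>[OF no])
    have "emeasure (interval_measure G) (\<Union>c\<in>K. c) \<le> (\<Sum>c\<in>K. emeasure (interval_measure G) c)"
      using K meas(3) by (intro emeasure_subadditive_finite) auto
    also have "\<dots> \<le> (\<Sum>c\<in>K. ennreal (norm (G (Sup c) - G (Inf c))))"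
    proof (rule sum_mono)
      fix c assume "c \<in> K"
      then have c: "c \<in> ?C" using K by auto
      have "emeasure (interval_measure G) c \<le> emeasure (interval_measure G) {Inf c<..Sup c}"
        by (subst comp(1)[OF c], rule emeasure_mono) auto
      also have "\<dots> = ennreal (G (Sup c) - G (Inf c))"
        using comp(5)[OF c] mono cont by (intro emeasure_interval_measure_Ioc) auto
      finally show "emeasure (interval_measure G) c \<le> ennreal (norm (G (Sup c) - G (Inf c)))"
        by (rule order_trans) (auto intro!: ennreal_leI)
    qed
    also have "\<dots> = ennreal (\<Sum>c\<in>K. norm (G (Sup c) - G (Inf c)))" by (simp add: sum_ennreal)
    also have "\<dots> \<le> ennreal \<epsilon>" using small by (intro ennreal_leI) simp
    finally show ?thesis by simp
  qed
  show ?thesis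
  proof (cases "?C = {}")
    case True
    then have "U = {}" by (simp add: components_eq_empty)
    then show ?thesis by simp
  next
    case False
    have "countable ?C"
    proof (rule countable_disjoint_open_subsets)
      show "\<And>S. S \<in> ?C \<Longrightarrow> open S" using comp(2) .
      show "disjoint ?C" unfolding disjoint_def
        using pairwise_disjoint_components[of U] by (auto simp: pairwise_def)
    qed
    then have ran: "range (from_nat_into ?C) = ?C" using False by (simp add: range_from_nat_into)
    define A where "A n = \<Union>(from_nat_into ?C ` {..<n})" for n
    have "\<Union>(range (from_nat_into ?C)) = (\<Union>n. A n)"
      unfolding A_def by blast
    then have "\<Union>?C = (\<Union>n. A n)" by (simp only: ran)
    then have "U = (\<Union>n. A n)" by (simp add: Union_components)
    moreover have "(SUP n. emeasure (interval_measure G) (A n)) = emeasure (interval_measure G) (\<Union>n. A n)"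
    proof (rule SUP_emeasure_incseq)
      have "open (A n)" for n
        unfolding A_def using comp(2) ran by (intro open_Union) auto
      then show "range A \<subseteq> sets (interval_measure G)" by auto
      show "incseq A" unfolding A_def by (intro incseq_SucI Union_mono image_mono) auto
    qed
    moreover have "(SUP n. emeasure (interval_measure G) (A n)) \<le> ennreal \<epsilon>"
      unfolding A_def using ran by (intro SUP_least fin) auto
    ultimately show ?thesis by simp
  qed
qed

text \<open>
  A null set is contained in open sets of arbitrarily small Lebesgue measure, and these have small
  Stieltjes measure. It is enough to treat the bounded parts of the null set, which keeps all intervals
  inside a range where absolute continuity is available.
\<close>

lemma absolutely_continuous_interval_measure:
  fixes G :: "real \<Rightarrow> real"
  assumes mono: "\<And>x y. x \<le> y \<Longrightarrow> G x \<le> G y" and cont: "\<And>x. continuous (at_right x) G"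
    and ac: "\<And>r. abs_continuous_on_Icc G (-r) r"
  shows "absolutely_continuous lborel (interval_measure G)"
  unfolding absolutely_continuous_def
proof
  fix N :: "real set" assume "N \<in> null_sets lborel"
  then have N: "N \<in> sets borel" "emeasure lborel N = 0" by auto
  let ?N = "\<lambda>r::nat. N \<inter> {-real r<..<real r}"
  have "emeasure (interval_measure G) (?N r) \<le> 0" for r
  proof (rule ennreal_le_epsilon)
    fix \<epsilon> :: real assume "\<epsilon> > 0"
    obtain \<delta> where \<delta>: "\<delta> > 0" "\<And>(J :: real set set) u v. nonoverlapping J u v (-real r) (real r) \<Longrightarrow>
       (\<Sum>j\<in>J. v j - u j) < \<delta> \<Longrightarrow> (\<Sum>j\<in>J. norm (G (v j) - G (u j))) < \<epsilon>"
      using abs_continuous_nonoverlapping[OF ac[of "real r"] \<open>\<epsilon> > 0\<close>] by blast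
    obtain U where U: "open U" "N \<subseteq> U" "emeasure lborel (U - N) < ennreal \<delta>"
      using outer_regular_lborel[OF N(1) \<delta>(1)] by blast
    let ?U = "U \<inter> {-real r<..<real r}"
    have "emeasure lborel ?U \<le> emeasure lborel ((U - N) \<union> N)"
      using U(1) N(1) by (intro emeasure_mono) auto
    also have "\<dots> \<le> emeasure lborel (U - N) + emeasure lborel N"
      using U(1) N(1) by (intro emeasure_subadditive) auto
    also have "\<dots> < ennreal \<delta>" using U(3) N(2) by simp
    finally have lt: "emeasure lborel ?U < ennreal \<delta>" .
    then have "measure lborel ?U < \<delta>"
    proof -
      have "emeasure lborel ?U \<noteq> top" using lt by auto
      from emeasure_eq_ennreal_measure[OF this] lt show ?thesis
        by (metis ennreal_less_iff measure_nonneg)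
    qed
    then have "emeasure (interval_measure G) ?U \<le> ennreal \<epsilon>"
      using U(1) by (intro interval_measure_open_le[OF mono cont _ _ _ \<delta>(2)]) auto
    moreover have "emeasure (interval_measure G) (?N r) \<le> emeasure (interval_measure G) ?U"
      using U by (intro emeasure_mono) auto
    ultimately show "emeasure (interval_measure G) (?N r) \<le> 0 + ennreal \<epsilon>" by simp
  qed
  then have "?N r \<in> null_sets (interval_measure G)" for r using N(1) by (auto simp: null_sets_def)
  then have "(\<Union>r. ?N r) \<in> null_sets (interval_measure G)" by (rule null_sets_UN)
  moreover have "(\<Union>r. ?N r) = N"
  proof -
    have "\<exists>r::nat. -real r < x \<and> x < real r" for x
    proof -
      obtain r :: nat where "\<bar>x\<bar> < real r" using reals_Archimedean2 by blast
      then show ?thesis by (intro exI[of _ r]) auto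
    qed
    then show ?thesis by auto
  qed
  ultimately show "N \<in> null_sets (interval_measure G)" by simp
qed

text \<open>
  The Stieltjes measure needs a function on the whole line. Extending \<open>g\<close> by its boundary values keeps
  it absolutely continuous because clamping shortens intervals.
\<close>

lemma abs_continuous_on_Icc_clamp:
  assumes ac: "abs_continuous_on_Icc g a b" and "a \<le> b"
  shows "abs_continuous_on_Icc (\<lambda>x. g (max a (min b x))) c d"
proof (rule abs_continuousI_nonoverlapping)
  fix \<epsilon> :: real assume "\<epsilon> > 0"
  obtain \<delta> where \<delta>: "\<delta> > 0" "\<And>(J :: (real \<times> real) set) u v. nonoverlapping J u v a b \<Longrightarrow>
       (\<Sum>j\<in>J. v j - u j) < \<delta> \<Longrightarrow> (\<Sum>j\<in>J. norm (g (v j) - g (u j))) < \<epsilon>"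
    using abs_continuous_nonoverlapping[OF ac \<open>\<epsilon> > 0\<close>] by blast
  show "\<exists>\<delta>>0. \<forall>(J :: (real \<times> real) set) u v. nonoverlapping J u v c d \<longrightarrow>
     (\<Sum>j\<in>J. v j - u j) < \<delta> \<longrightarrow> (\<Sum>j\<in>J. norm (g (max a (min b (v j))) - g (max a (min b (u j))))) < \<epsilon>"
  proof (intro exI[of _ \<delta>] conjI \<delta>(1) allI impI)
    fix J :: "(real \<times> real) set" and u v
    assume J: "nonoverlapping J u v c d" and len: "(\<Sum>j\<in>J. v j - u j) < \<delta>"
    have "(\<Sum>j\<in>J. max a (min b (v j)) - max a (min b (u j))) \<le> (\<Sum>j\<in>J. v j - u j)"
      by (rule sum_mono) (use J in \<open>auto simp: nonoverlapping_def max_def min_def\<close>)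
    then show "(\<Sum>j\<in>J. norm (g (max a (min b (v j))) - g (max a (min b (u j))))) < \<epsilon>"
      using len by (intro \<delta>(2)[OF nonoverlapping_clamp[OF J \<open>a \<le> b\<close>]]) simp
  qed
qed

text \<open>
  The integrand is the Radon--Nikodym density of the Stieltjes measure of \<open>F\<close> (extended by constants
  outside \<open>[a,b]\<close>), evaluated on the intervals \<open>[a,x]\<close>.
\<close>

lemma monotone_abs_continuous_has_integral:
  fixes F :: "real \<Rightarrow> real"
  assumes "a \<le> b" and mono: "mono_on {a..b} F" and ac: "abs_continuous_on_Icc F a b"
  obtains f where "integrable lborel f" "\<And>x. x \<in> {a..b} \<Longrightarrow> (f has_integral (F x - F a)) {a..x}"
proof -
  define G where "G x = F (max a (min b x))" for x
  have G_eq: "G x = F x" if "x \<in> {a..b}" for x using that by (simp add: G_def)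
  have mono_G: "G x \<le> G y" if "x \<le> y" for x y
    unfolding G_def using that \<open>a \<le> b\<close> by (intro mono_onD[OF mono]) auto
  have ac_G: "abs_continuous_on_Icc G c d" for c d
    unfolding G_def by (rule abs_continuous_on_Icc_clamp[OF ac \<open>a \<le> b\<close>])
  have cont_UNIV: "continuous_on UNIV G"
    unfolding G_def
    by (rule continuous_on_compose2[OF abs_continuous_on_Icc_continuous_on[OF ac]])
      (use \<open>a \<le> b\<close> in \<open>auto intro!: continuous_intros\<close>)
  then have isC: "isCont G x" for x by (simp add: continuous_on_eq_continuous_at)
  then have cont_G: "continuous (at_right x) G" for x by (rule continuous_at_imp_continuous_at_within)
  let ?\<mu> = "interval_measure G"
  have "absolutely_continuous lborel ?\<mu>"
    by (rule absolutely_continuous_interval_measure[OF mono_G cont_G ac_G])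
  then obtain h where h[measurable]: "h \<in> borel_measurable lborel" and dens: "density lborel h = ?\<mu>"
    using sigma_finite_measure.Radon_Nikodym[OF sigma_finite_lborel, of ?\<mu>] by auto
  have nn_h: "(\<integral>\<^sup>+t. h t * indicator {a..x} t \<partial>lborel) = ennreal (F x - F a)" if "x \<in> {a..b}" for x
  proof -
    have "(\<integral>\<^sup>+t. h t * indicator {a..x} t \<partial>lborel) = emeasure ?\<mu> {a..x}"
      unfolding dens[symmetric] by (simp add: emeasure_density)
    also have "\<dots> = ennreal (G x - G a)"
      using that mono_G cont_UNIV by (intro emeasure_interval_measure_Icc) auto
    finally show ?thesis using that G_eq[of x] G_eq[of a] by simp
  qed
  \<comment> \<open>The density may be infinite on a null set; \<open>enn2real\<close> replaces those values by \<open>0\<close>.\<close>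
  define f where "f t = enn2real (h t * indicator {a..b} t)" for t
  have [measurable]: "f \<in> borel_measurable lborel" unfolding f_def by measurable
  have fin: "AE t in lborel. h t * indicator {a..b} t \<noteq> \<infinity>"
    by (rule nn_integral_PInf_AE) (use nn_h[of b] \<open>a \<le> b\<close> in auto)
  have nn_f: "(\<integral>\<^sup>+t. ennreal (f t * indicator {a..x} t) \<partial>lborel) = ennreal (F x - F a)" if "x \<in> {a..b}" for x
  proof -
    have "(\<integral>\<^sup>+t. ennreal (f t * indicator {a..x} t) \<partial>lborel) = (\<integral>\<^sup>+t. h t * indicator {a..x} t \<partial>lborel)"
    proof (rule nn_integral_cong_AE, use fin in eventually_elim)
      fix t assume *: "h t * indicator {a..b} t \<noteq> \<infinity>"
      then show "ennreal (f t * indicator {a..x} t) = h t * indicator {a..x} t"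
        using that by (auto simp: f_def indicator_def less_top split: if_splits)
    qed
    then show ?thesis using nn_h[OF that] by simp
  qed
  have bochner: "has_bochner_integral lborel (\<lambda>t. f t * indicator {a..x} t) (F x - F a)" if "x \<in> {a..b}" for x
  proof (rule has_bochner_integral_nn_integral)
    show "0 \<le> F x - F a" using mono_onD[OF mono, of a x] that by simp
  qed (use nn_f[OF that] in \<open>auto simp: f_def\<close>)
  show thesis
  proof (rule that)
    have "(\<lambda>t. f t * indicator {a..b} t) = f" by (auto simp: f_def indicator_def)
    then show "integrable lborel f" using bochner[of b] \<open>a \<le> b\<close> by (auto simp: has_bochner_integral_iff)
    fix x assume x: "x \<in> {a..b}"
    have "((\<lambda>t. f t * indicator {a..x} t) has_integral (F x - F a)) UNIV"
      using has_integral_integral_lborel bochner[OF x] by (metis has_bochner_integral_iff)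
    moreover have "(\<lambda>t. f t * indicator {a..x} t) = (\<lambda>t. if t \<in> {a..x} then f t else 0)"
      by (auto simp: indicator_def)
    ultimately show "(f has_integral (F x - F a)) {a..x}"
      by (simp only: has_integral_restrict_UNIV)
  qed
qed

text \<open>
  Both \<open>T\<close> and \<open>T - \<phi>\<close> are increasing and absolutely continuous if \<open>T\<close> is the variation function of
  \<open>g\<close> and \<open>\<phi>\<close> its real or imaginary part, so \<open>\<phi> = T - (T - \<phi>)\<close> is an indefinite integral.
\<close>

lemma abs_continuous_has_integral:
  fixes g :: "real \<Rightarrow> complex"
  assumes "a \<le> b" and ac: "abs_continuous_on_Icc g a b"
  obtains f where "integrable lborel f" "\<And>x. x \<in> {a..b} \<Longrightarrow> (f has_integral (g x - g a)) {a..x}"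
proof -
  define T where "T = variation g a"
  have bv: "bounded_variation g a b" by (rule abs_continuous_bounded_variation[OF ac])
  have acT: "abs_continuous_on_Icc T a b" unfolding T_def by (rule abs_continuous_variation[OF ac])
  have T: "norm (g y - g x) \<le> T y - T x" if "a \<le> x" "x \<le> y" "y \<le> b" for x y
  proof -
    have "T y = T x + variation g x y" unfolding T_def
      by (rule variation_additive[OF bounded_variation_subinterval[OF bv]]) (use that in auto)
    moreover have "norm (g y - g x) \<le> variation g x y"
      by (rule norm_diff_le_variation[OF bounded_variation_subinterval[OF bv]]) (use that in auto)
    ultimately show ?thesis by simp
  qed
  have part: "\<exists>f. integrable lborel f \<and> (\<forall>x\<in>{a..b}. (f has_integral (\<phi> x - \<phi> a)) {a..x})"
    if \<phi>: "\<And>x y. \<bar>\<phi> y - \<phi> x\<bar> \<le> norm (g y - g x)" for \<phi> :: "real \<Rightarrow> real"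
  proof -
    have \<phi>T: "\<bar>\<phi> y - \<phi> x\<bar> \<le> T y - T x" if "a \<le> x" "x \<le> y" "y \<le> b" for x y
      using \<phi>[of y x] T[OF that] by simp
    have "mono_on {a..b} T" using T by (intro mono_onI) (smt (verit) atLeastAtMost_iff norm_ge_zero)
    then obtain f1 where f1: "integrable lborel f1" "\<And>x. x \<in> {a..b} \<Longrightarrow> (f1 has_integral (T x - T a)) {a..x}"
      using monotone_abs_continuous_has_integral[OF \<open>a \<le> b\<close> _ acT] by blast
    have "mono_on {a..b} (\<lambda>x. T x - \<phi> x)" using \<phi>T by (intro mono_onI) (smt (verit) atLeastAtMost_iff)
    moreover have "abs_continuous_on_Icc (\<lambda>x. T x - \<phi> x) a b"
      by (rule abs_continuous_on_Icc_dominated[OF acT, of _ 2]) (use \<phi>T in \<open>fastforce simp: abs_le_iff\<close>)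
    ultimately obtain f2 where f2: "integrable lborel f2"
      "\<And>x. x \<in> {a..b} \<Longrightarrow> (f2 has_integral ((T x - \<phi> x) - (T a - \<phi> a))) {a..x}"
      using monotone_abs_continuous_has_integral[OF \<open>a \<le> b\<close>] by blast
    have "((\<lambda>t. f1 t - f2 t) has_integral (\<phi> x - \<phi> a)) {a..x}" if "x \<in> {a..b}" for x
      using has_integral_diff[OF f1(2) f2(2), OF that that] by simp
    then show ?thesis using f1(1) f2(1) by (intro exI[of _ "\<lambda>t. f1 t - f2 t"]) auto
  qed
  obtain f1 where f1: "integrable lborel f1"
     "\<And>x. x \<in> {a..b} \<Longrightarrow> (f1 has_integral (Re (g x) - Re (g a))) {a..x}"
    using part[of "\<lambda>x. Re (g x)"] abs_Re_le_cmod by (metis minus_complex.simps(1))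
  obtain f2 where f2: "integrable lborel f2"
     "\<And>x. x \<in> {a..b} \<Longrightarrow> (f2 has_integral (Im (g x) - Im (g a))) {a..x}"
    using part[of "\<lambda>x. Im (g x)"] abs_Im_le_cmod by (metis minus_complex.simps(2))
  show thesis
  proof (rule that)
    let ?f = "\<lambda>t. complex_of_real (f1 t) + \<i> * complex_of_real (f2 t)"
    show "integrable lborel ?f"
      using f1(1) f2(1) by (intro Bochner_Integration.integrable_add integrable_mult_right integrable_of_real)
    fix x assume x: "x \<in> {a..b}"
    have "(?f has_integral (complex_of_real (Re (g x) - Re (g a)) + \<i> * complex_of_real (Im (g x) - Im (g a)))) {a..x}"
      by (intro has_integral_add has_integral_mult_right)
        (use has_integral_linear[OF f1(2)[OF x] bounded_linear_of_real]
           has_integral_linear[OF f2(2)[OF x] bounded_linear_of_real] in \<open>simp_all add: o_def\<close>)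
    also have "complex_of_real (Re (g x) - Re (g a)) + \<i> * complex_of_real (Im (g x) - Im (g a)) = g x - g a"
      by (simp add: complex_eq_iff)
    finally show "(?f has_integral (g x - g a)) {a..x}" .
  qed
qed

section \<open>Differentiability almost everywhere\<close>

text \<open>
  Lebesgue's differentiation theorem in the form \<open>integrable_ccontinuous_explicit\<close> concerns the
  averages over \<open>[x, x + h]\<close> with \<open>h > 0\<close> and so yields the right derivative. The left derivative at
  \<open>x\<close> comes from the same theorem for \<open>t \<mapsto> f(-t)\<close> at \<open>-x\<close>.
\<close>

lemma indefinite_integral_derivative_ae:
  fixes f :: "real \<Rightarrow> 'a::euclidean_space"
  assumes f: "\<And>a b. f integrable_on {a..b}"
    and g: "\<And>x. x \<in> {a..b} \<Longrightarrow> (f has_integral (g x - g a)) {a..x}"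
  obtains N where "negligible N" "\<And>x. x \<in> {a<..<b} - N \<Longrightarrow> (g has_vector_derivative f x) (at x)"
proof -
  have incr: "integral {x..y} f = g y - g x" if "a \<le> x" "x \<le> y" "y \<le> b" for x y
  proof -
    have "(f has_integral (g x - g a + integral {x..y} f)) {a..y}"
      by (rule has_integral_combine[of a x y]) (use that g f in \<open>auto intro: integrable_integral\<close>)
    moreover have "(f has_integral (g y - g a)) {a..y}" using g that by simp
    ultimately have "g x - g a + integral {x..y} f = g y - g a" by (rule has_integral_unique)
    then show ?thesis by (simp add: algebra_simps)
  qed
  obtain N1 where N1: "negligible N1" "\<And>x e. x \<notin> N1 \<Longrightarrow> 0 < e \<Longrightarrow> \<exists>d>0. \<forall>h. 0 < h \<and> h < d \<longrightarrow>
       norm (integral (cbox x (x + h *\<^sub>R One)) f /\<^sub>R h ^ DIM(real) - f x) < e"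
    using integrable_ccontinuous_explicit[of f] f by (metis cbox_interval)
  have "(\<lambda>t. f (- t)) integrable_on {c..d}" for c d
    using Henstock_Kurzweil_Integration.integrable_reflect_real[of f "-c" "-d"] f by simp
  then obtain N2 where N2: "negligible N2" "\<And>x e. x \<notin> N2 \<Longrightarrow> 0 < e \<Longrightarrow> \<exists>d>0. \<forall>h. 0 < h \<and> h < d \<longrightarrow>
       norm (integral (cbox x (x + h *\<^sub>R One)) (\<lambda>t. f (- t)) /\<^sub>R h ^ DIM(real) - f (- x)) < e"
    using integrable_ccontinuous_explicit[of "\<lambda>t. f (- t)"] by (metis cbox_interval)
  show thesis
  proof (rule that)
    have "negligible (uminus ` N2)"
      by (rule negligible_differentiable_image_negligible[OF order_refl N2(1)])
        (auto simp: differentiable_on_def)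
    then show "negligible (N1 \<union> uminus ` N2)" using N1(1) by simp
    fix x assume x: "x \<in> {a<..<b} - (N1 \<union> uminus ` N2)"
    then have xN: "x \<notin> N1" "- x \<notin> N2" by (auto simp: image_iff)
    show "(g has_vector_derivative f x) (at x)"
      unfolding has_vector_derivative_def has_derivative_at_alt
    proof (intro conjI bounded_linear_scaleR_left allI impI)
      fix e :: real assume "0 < e"
      obtain d1 where d1: "d1 > 0" "\<And>h. 0 < h \<Longrightarrow> h < d1 \<Longrightarrow> norm (integral {x..x + h} f /\<^sub>R h - f x) < e"
        using N1(2)[OF xN(1) \<open>0 < e\<close>] by auto
      obtain d2 where d2: "d2 > 0"
        "\<And>h. 0 < h \<Longrightarrow> h < d2 \<Longrightarrow> norm (integral {-x..-x + h} (\<lambda>t. f (- t)) /\<^sub>R h - f x) < e"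
        using N2(2)[OF xN(2) \<open>0 < e\<close>] by auto
      have scale: "norm (v - h *\<^sub>R w) \<le> e * h" if "norm (v /\<^sub>R h - w) < e" "h > 0" for v w :: 'a and h
      proof -
        have "v - h *\<^sub>R w = h *\<^sub>R (v /\<^sub>R h - w)" using that by (simp add: algebra_simps)
        then have "norm (v - h *\<^sub>R w) = h * norm (v /\<^sub>R h - w)" using that by simp
        then show ?thesis using that by (simp add: mult.commute)
      qed
      show "\<exists>d>0. \<forall>y. norm (y - x) < d \<longrightarrow> norm (g y - g x - (y - x) *\<^sub>R f x) \<le> e * norm (y - x)"
      proof (intro exI[of _ "min (min d1 d2) (min (x - a) (b - x))"] conjI allI impI)
        show "0 < min (min d1 d2) (min (x - a) (b - x))" using d1(1) d2(1) x by simp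
        fix y assume "norm (y - x) < min (min d1 d2) (min (x - a) (b - x))"
        then have y: "\<bar>y - x\<bar> < d1" "\<bar>y - x\<bar> < d2" "a \<le> y" "y \<le> b" by auto
        consider "y = x" | "x < y" | "y < x" by linarith
        then show "norm (g y - g x - (y - x) *\<^sub>R f x) \<le> e * norm (y - x)"
        proof cases
          case 2
          have "norm (integral {x..x + (y - x)} f - (y - x) *\<^sub>R f x) \<le> e * (y - x)"
            by (rule scale[OF d1(2)]) (use 2 y in auto)
          then show ?thesis using incr[of x y] 2 x y by simp
        next
          case 3
          have "norm (integral {-x..-x + (x - y)} (\<lambda>t. f (- t)) - (x - y) *\<^sub>R f x) \<le> e * (x - y)"
            by (rule scale[OF d2(2)]) (use 3 y in auto)
          also have "integral {-x..-x + (x - y)} (\<lambda>t. f (- t)) = integral {y..x} f"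
            using integral_reflect_real[of x y f] by simp
          also have "\<dots> = g x - g y" using incr[of y x] 3 x y by simp
          also have "norm (g x - g y - (x - y) *\<^sub>R f x) = norm (g y - g x - (y - x) *\<^sub>R f x)"
            by (subst norm_minus_commute) (simp add: algebra_simps)
          finally show ?thesis using 3 by simp
        qed simp
      qed
    qed
  qed
qed

text \<open>
  The integrand that represents \<open>g\<close> agrees almost everywhere with the derivative of \<open>g\<close>. The
  nonnegative integral keeps the bound meaningful when the derivative is not known to be integrable.
\<close>

lemma abs_continuous_norm_diff_le:
  fixes g :: "real \<Rightarrow> complex"
  assumes ac: "abs_continuous_on_Icc g a b" and "a \<le> b"
  shows "ennreal (norm (g b - g a)) \<le>
    (\<integral>\<^sup>+t. ennreal (norm (vector_derivative g (at t))) * indicator {a..b} t \<partial>lebesgue)"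
proof -
  obtain f where f: "integrable lborel f" "\<And>x. x \<in> {a..b} \<Longrightarrow> (f has_integral (g x - g a)) {a..x}"
    using abs_continuous_has_integral[OF \<open>a \<le> b\<close> ac] by blast
  have "f integrable_on UNIV" using f(1) by (rule integrable_on_lborel)
  then have "f integrable_on {c..d}" for c d
    using integrable_on_subcbox[of f UNIV c d] by simp
  then obtain N where N: "negligible N" "\<And>x. x \<in> {a<..<b} - N \<Longrightarrow> (g has_vector_derivative f x) (at x)"
    using indefinite_integral_derivative_ae[OF _ f(2)] by blast
  have int: "integrable lborel (\<lambda>t. indicator {a..b} t *\<^sub>R f t)"
    using f(1) by (intro integrable_mult_indicator) auto
  have restr: "(\<lambda>t. indicator {a..b} t *\<^sub>R f t) = (\<lambda>t. if t \<in> {a..b} then f t else 0)"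
    by (auto simp: indicator_def)
  have "(f has_integral (LINT t|lborel. indicator {a..b} t *\<^sub>R f t)) {a..b}"
    using has_integral_integral_lborel[OF int] unfolding restr by (simp only: has_integral_restrict_UNIV)
  then have eq: "g b - g a = (LINT t|lborel. indicator {a..b} t *\<^sub>R f t)"
    using f(2)[of b] \<open>a \<le> b\<close> by (auto dest: has_integral_unique)
  have "ennreal (norm (g b - g a)) \<le> (\<integral>\<^sup>+t. ennreal (norm (indicator {a..b} t *\<^sub>R f t)) \<partial>lborel)"
    unfolding eq by (rule integral_norm_bound_ennreal[OF int])
  also have "\<dots> = (\<integral>\<^sup>+t. ennreal (norm (indicator {a..b} t *\<^sub>R f t)) \<partial>lebesgue)"
    by (rule nn_integral_completion[symmetric])
  also have "\<dots> = (\<integral>\<^sup>+t. ennreal (norm (vector_derivative g (at t))) * indicator {a..b} t \<partial>lebesgue)"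
  proof (rule nn_integral_cong_AE)
    have "negligible (N \<union> {a, b})" using N(1) by simp
    then have "AE t in lebesgue. t \<notin> N \<union> {a, b}"
      by (intro AE_not_in) (simp add: negligible_iff_null_sets)
    then show "AE t in lebesgue. ennreal (norm (indicator {a..b} t *\<^sub>R f t)) =
      ennreal (norm (vector_derivative g (at t))) * indicator {a..b} t"
    proof eventually_elim
      case (elim t)
      then show ?case
        using vector_derivative_at[OF N(2)[of t]] by (auto simp: indicator_def)
    qed
  qed
  finally show ?thesis .
qed

section \<open>A weighted Hardy inequality\<close>

lemma measurable_ident_lebesgue_on:
  fixes S :: "'a::euclidean_space set"
  assumes "S \<in> sets lebesgue"
  shows "(\<lambda>x. x) \<in> borel_measurable (lebesgue_on S)"
  by (rule continuous_imp_measurable_on_sets_lebesgue[OF continuous_on_id assms])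

lemma mult_weight_le:
  fixes t x :: real
  assumes "\<bar>t\<bar> \<le> \<bar>x\<bar>" "\<bar>x\<bar> < 1"
  shows "0 \<le> (1 - x\<^sup>2) ^ k" "(1 - x\<^sup>2) ^ k \<le> (1 - t\<^sup>2) ^ k"
proof -
  have "t\<^sup>2 \<le> x\<^sup>2" using assms(1) by (simp add: abs_le_square_iff)
  moreover have "x\<^sup>2 \<le> 1" using assms(2) by (simp add: abs_square_le_1)
  ultimately show "0 \<le> (1 - x\<^sup>2) ^ k" "(1 - x\<^sup>2) ^ k \<le> (1 - t\<^sup>2) ^ k"
    by (auto intro!: power_mono)
qed

text \<open>
  Cauchy--Schwarz against the constant \<open>1\<close>; the factor \<open>2\<close> is the length of \<open>(-1,1)\<close>.
\<close>

lemma square_abs_continuous_increment_le: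
  fixes g :: "real \<Rightarrow> complex"
  defines "M \<equiv> lebesgue_on {-1<..<1::real}"
  assumes ac: "\<And>c d. -1 < c \<Longrightarrow> c \<le> d \<Longrightarrow> d < 1 \<Longrightarrow> abs_continuous_on_Icc g c d"
    and meas: "(\<lambda>t. vector_derivative g (at t)) \<in> borel_measurable M"
    and x: "x \<in> {-1<..<1}"
  shows "ennreal ((norm (g x - g 0))\<^sup>2) \<le>
    2 * (\<integral>\<^sup>+t. ennreal ((norm (vector_derivative g (at t)))\<^sup>2) * indicator {min 0 x..max 0 x} t \<partial>M)"
proof -
  let ?D = "\<lambda>t. vector_derivative g (at t)"
  let ?B = "{min 0 x..max 0 x}"
  have B: "?B \<subseteq> {-1<..<1}" using x by auto
  have [measurable]: "?D \<in> borel_measurable M" by (rule meas)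
  have [measurable]: "(\<lambda>x. x) \<in> borel_measurable M"
    unfolding M_def by (rule measurable_ident_lebesgue_on) simp
  have "ennreal (norm (g x - g 0)) = ennreal (norm (g (max 0 x) - g (min 0 x)))"
    by (cases "0 \<le> x") (simp_all add: norm_minus_commute max_def min_def)
  also have "\<dots> \<le> (\<integral>\<^sup>+t. ennreal (norm (?D t)) * indicator ?B t \<partial>lebesgue)"
    by (rule abs_continuous_norm_diff_le[OF ac]) (use x in auto)
  also have "\<dots> = (\<integral>\<^sup>+t. ennreal (norm (?D t)) * indicator ?B t * indicator {-1<..<1} t \<partial>lebesgue)"
    by (rule nn_integral_cong) (use B in \<open>auto simp add: indicator_def subset_iff\<close>)
  also have "\<dots> = (\<integral>\<^sup>+t. ennreal (norm (?D t)) * indicator ?B t \<partial>M)"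
    unfolding M_def by (rule nn_integral_restrict_space[symmetric]) simp
  also have "\<dots> = (\<integral>\<^sup>+t. 1 * (ennreal (norm (?D t)) * indicator ?B t) \<partial>M)" by simp
  finally have "(ennreal (norm (g x - g 0)))\<^sup>2 \<le> (\<integral>\<^sup>+t. 1 * (ennreal (norm (?D t)) * indicator ?B t) \<partial>M)\<^sup>2"
    by (rule power_mono) simp
  also have "\<dots> \<le> (\<integral>\<^sup>+t. 1\<^sup>2 \<partial>M) * (\<integral>\<^sup>+t. (ennreal (norm (?D t)) * indicator ?B t)\<^sup>2 \<partial>M)"
    by (intro Cauchy_Schwarz_nn_integral) measurable
  also have "(\<integral>\<^sup>+t. 1\<^sup>2 \<partial>M) = (2 :: ennreal)"
    by (simp add: M_def emeasure_restrict_space space_restrict_space)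
  also have "(\<integral>\<^sup>+t. (ennreal (norm (?D t)) * indicator ?B t)\<^sup>2 \<partial>M) =
      (\<integral>\<^sup>+t. ennreal ((norm (?D t))\<^sup>2) * indicator ?B t \<partial>M)"
    by (intro nn_integral_cong) (simp add: indicator_def ennreal_power)
  finally show ?thesis by (simp add: ennreal_power)
qed

text \<open>
  The joint measurability that Tonelli's theorem requires.
\<close>

lemma measurable_segment_indicator:
  fixes h :: "real \<Rightarrow> ennreal"
  defines "M \<equiv> lebesgue_on {-1<..<1::real}"
  assumes h: "h \<in> borel_measurable M"
  shows "(\<lambda>(x, t). h t * indicator {min 0 x..max 0 x} t) \<in> borel_measurable (M \<Otimes>\<^sub>M M)"
proof -
  have id: "(\<lambda>x. x) \<in> borel_measurable M"
    unfolding M_def by (rule measurable_ident_lebesgue_on) simp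
  have [measurable]: "fst \<in> borel_measurable (M \<Otimes>\<^sub>M M)" "snd \<in> borel_measurable (M \<Otimes>\<^sub>M M)"
    by (rule measurable_compose[OF measurable_fst id] measurable_compose[OF measurable_snd id])+
  have [measurable]: "(\<lambda>p. h (snd p)) \<in> borel_measurable (M \<Otimes>\<^sub>M M)"
    by (rule measurable_compose[OF measurable_snd h])
  have "(\<lambda>(x, t). h t * indicator {min 0 x..max 0 x} t) =
     (\<lambda>p. h (snd p) * (if min 0 (fst p) \<le> snd p \<and> snd p \<le> max 0 (fst p) then 1 else 0))"
    by (auto simp: indicator_def)
  also have "\<dots> \<in> borel_measurable (M \<Otimes>\<^sub>M M)" by measurable
  finally show ?thesis .
qed

text \<open>
  After the exchange of the integrals, the points \<open>x\<close> with \<open>t\<close> between \<open>0\<close> and \<open>x\<close> satisfy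
  \<open>|t| \<le> |x| < 1\<close>. There the weight \<open>1 - x\<^sup>2\<close> is at most \<open>1 - t\<^sup>2\<close>, and they form a set of measure at
  most \<open>2(1 - |t|) \<le> 2(1 - t\<^sup>2)\<close>, which supplies the additional power of the weight.
\<close>

lemma hardy_weighted_fubini:
  fixes h :: "real \<Rightarrow> ennreal"
  defines "M \<equiv> lebesgue_on {-1<..<1::real}"
  assumes h[measurable]: "h \<in> borel_measurable M"
  shows "(\<integral>\<^sup>+x. ennreal ((1 - x\<^sup>2) ^ k) * (\<integral>\<^sup>+t. h t * indicator {min 0 x..max 0 x} t \<partial>M) \<partial>M) \<le>
    2 * (\<integral>\<^sup>+t. ennreal ((1 - t\<^sup>2) ^ Suc k) * h t \<partial>M)"
proof -
  interpret finite_measure M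
    unfolding M_def by (rule finite_measure_lebesgue_on) simp
  interpret pair_sigma_finite M M ..
  have id: "(\<lambda>x. x) \<in> borel_measurable M"
    unfolding M_def by (rule measurable_ident_lebesgue_on) simp
  have [measurable]: "(\<lambda>p. fst p) \<in> borel_measurable (M \<Otimes>\<^sub>M M)"
    by (rule measurable_compose[OF measurable_fst id])
  let ?w = "\<lambda>x::real. ennreal ((1 - x\<^sup>2) ^ k)"
  let ?K = "\<lambda>t x. indicator {min 0 x..max 0 x} t :: ennreal"
  have joint: "(\<lambda>(x, t). h t * ?K t x) \<in> borel_measurable (M \<Otimes>\<^sub>M M)"
    unfolding M_def by (rule measurable_segment_indicator[OF h[unfolded M_def]])
  then have joint': "(\<lambda>(x, t). ?w x * (h t * ?K t x)) \<in> borel_measurable (M \<Otimes>\<^sub>M M)"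
    unfolding case_prod_beta' by measurable
  have "(\<integral>\<^sup>+x. ?w x * (\<integral>\<^sup>+t. h t * ?K t x \<partial>M) \<partial>M) = (\<integral>\<^sup>+x. (\<integral>\<^sup>+t. ?w x * (h t * ?K t x) \<partial>M) \<partial>M)"
  proof (rule nn_integral_cong, rule nn_integral_cmult[symmetric])
    fix x assume "x \<in> space M"
    from measurable_compose[OF measurable_Pair1'[OF this] joint]
    show "(\<lambda>t. h t * ?K t x) \<in> borel_measurable M" by simp
  qed
  also have "\<dots> = (\<integral>\<^sup>+t. (\<integral>\<^sup>+x. ?w x * (h t * ?K t x) \<partial>M) \<partial>M)"
    by (rule Fubini'[symmetric, OF joint'])
  also have "\<dots> \<le> (\<integral>\<^sup>+t. 2 * (ennreal ((1 - t\<^sup>2) ^ Suc k) * h t) \<partial>M)"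
  proof (rule nn_integral_mono)
    fix t assume "t \<in> space M"
    then have t: "\<bar>t\<bar> < 1" by (auto simp: M_def space_restrict_space)
    let ?S = "{-1<..-\<bar>t\<bar>} \<union> {\<bar>t\<bar>..<1}"
    have "(\<integral>\<^sup>+x. ?w x * (h t * ?K t x) \<partial>M) \<le> (\<integral>\<^sup>+x. (?w t * h t) * indicator ?S x \<partial>M)"
    proof (rule nn_integral_mono)
      fix x assume "x \<in> space M"
      then have x: "\<bar>x\<bar> < 1" by (auto simp: M_def space_restrict_space)
      show "?w x * (h t * ?K t x) \<le> (?w t * h t) * indicator ?S x"
      proof (cases "min 0 x \<le> t \<and> t \<le> max 0 x")
        case True
        then have "\<bar>t\<bar> \<le> \<bar>x\<bar>" "x \<in> ?S" using x by (auto simp: min_def max_def split: if_splits)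
        then show ?thesis
          using mult_weight_le[OF _ x, of t k] by (auto simp: indicator_def intro!: mult_right_mono ennreal_leI)
      qed (auto simp: indicator_def)
    qed
    also have "\<dots> = ?w t * h t * emeasure M ?S"
      unfolding M_def by (rule nn_integral_cmult_indicator) (auto simp: sets_restrict_space_iff)
    also have "emeasure M ?S = emeasure lebesgue ?S"
      unfolding M_def using t by (intro emeasure_restrict_space) auto
    also have "\<dots> \<le> emeasure lebesgue {-1<..-\<bar>t\<bar>} + emeasure lebesgue {\<bar>t\<bar>..<1}"
      by (rule emeasure_subadditive) auto
    also have "\<dots> = ennreal (1 - \<bar>t\<bar>) + ennreal (1 - \<bar>t\<bar>)" using t by simp
    also have "\<dots> = 2 * ennreal (1 - \<bar>t\<bar>)" by (simp add: mult_2)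
    also have "ennreal (1 - \<bar>t\<bar>) \<le> ennreal (1 - t\<^sup>2)"
    proof (rule ennreal_leI)
      have "\<bar>t\<bar> * \<bar>t\<bar> \<le> 1 * \<bar>t\<bar>" using t by (intro mult_right_mono) auto
      then show "1 - \<bar>t\<bar> \<le> 1 - t\<^sup>2" by (simp add: power2_eq_square)
    qed
    finally have "(\<integral>\<^sup>+x. ?w x * (h t * ?K t x) \<partial>M) \<le> ?w t * h t * (2 * ennreal (1 - t\<^sup>2))"
      by (simp add: mult_left_mono)
    also have "\<dots> = 2 * (ennreal ((1 - t\<^sup>2) ^ Suc k) * h t)"
      using mult_weight_le(1)[OF order_refl t, of k] mult_weight_le(1)[OF order_refl t, of 1]
      by (simp add: ennreal_mult ac_simps)
    finally show "(\<integral>\<^sup>+x. ?w x * (h t * ?K t x) \<partial>M) \<le> 2 * (ennreal ((1 - t\<^sup>2) ^ Suc k) * h t)" .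
  qed
  also have "\<dots> = 2 * (\<integral>\<^sup>+t. ennreal ((1 - t\<^sup>2) ^ Suc k) * h t \<partial>M)"
  proof (rule nn_integral_cmult)
    show "(\<lambda>t. ennreal ((1 - t\<^sup>2) ^ Suc k) * h t) \<in> borel_measurable M" using id h by measurable
  qed
  finally show ?thesis .
qed

text \<open>
  Split \<open>|g(x)|\<^sup>2 \<le> 2|g(0)|\<^sup>2 + 2|g(x) - g(0)|\<^sup>2\<close>. The first term is bounded on a set of finite measure,
  the second is covered by the two preceding estimates.
\<close>

lemma weighted_hardy_step:
  fixes g :: "real \<Rightarrow> complex"
  defines "M \<equiv> lebesgue_on {-1<..<1::real}"
  assumes ac: "\<And>c d. -1 < c \<Longrightarrow> c \<le> d \<Longrightarrow> d < 1 \<Longrightarrow> abs_continuous_on_Icc g c d"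
    and meas: "(\<lambda>t. vector_derivative g (at t)) \<in> borel_measurable M"
    and fin: "(\<integral>\<^sup>+t. ennreal ((1 - t\<^sup>2) ^ Suc k * (norm (vector_derivative g (at t)))\<^sup>2) \<partial>M) < \<infinity>"
  shows "(\<integral>\<^sup>+x. ennreal ((1 - x\<^sup>2) ^ k * (norm (g x))\<^sup>2) \<partial>M) < \<infinity>"
proof -
  let ?h = "\<lambda>t. ennreal ((norm (vector_derivative g (at t)))\<^sup>2)"
  let ?w = "\<lambda>x::real. ennreal ((1 - x\<^sup>2) ^ k)"
  let ?J = "\<lambda>x. \<integral>\<^sup>+t. ?h t * indicator {min 0 x..max 0 x} t \<partial>M"
  have [measurable]: "(\<lambda>t. vector_derivative g (at t)) \<in> borel_measurable M" by (rule meas)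
  have h[measurable]: "?h \<in> borel_measurable M" by measurable
  have space: "x \<in> space M \<longleftrightarrow> \<bar>x\<bar> < 1" for x by (auto simp: M_def space_restrict_space)
  interpret finite_measure M
    unfolding M_def by (rule finite_measure_lebesgue_on) simp
  have id[measurable]: "(\<lambda>x. x) \<in> borel_measurable M"
    unfolding M_def by (rule measurable_ident_lebesgue_on) simp
  have "(\<integral>\<^sup>+x. ennreal ((1 - x\<^sup>2) ^ k * (norm (g x))\<^sup>2) \<partial>M) \<le>
      (\<integral>\<^sup>+x. ennreal (2 * (norm (g 0))\<^sup>2) + 4 * (?w x * ?J x) \<partial>M)"
  proof (rule nn_integral_mono)
    fix x assume x: "x \<in> space M"
    then have x1: "\<bar>x\<bar> < 1" by (simp add: space)
    have w: "0 \<le> (1 - x\<^sup>2) ^ k" "(1 - x\<^sup>2) ^ k \<le> 1"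
      using mult_weight_le[of 0 x k] x1 by simp_all
    have "norm (g x) \<le> norm (g 0) + norm (g x - g 0)"
      using norm_triangle_ineq[of "g 0" "g x - g 0"] by simp
    then have "(norm (g x))\<^sup>2 \<le> (norm (g 0) + norm (g x - g 0))\<^sup>2" by (rule power_mono) simp
    also have "\<dots> \<le> 2 * (norm (g 0))\<^sup>2 + 2 * (norm (g x - g 0))\<^sup>2"
      using sum_squares_bound[of "norm (g 0)" "norm (g x - g 0)"] by (simp add: power2_sum)
    finally have "(1 - x\<^sup>2) ^ k * (norm (g x))\<^sup>2 \<le>
        (1 - x\<^sup>2) ^ k * (2 * (norm (g 0))\<^sup>2) + (1 - x\<^sup>2) ^ k * (2 * (norm (g x - g 0))\<^sup>2)"
      unfolding distrib_left[symmetric] by (rule mult_left_mono[OF _ w(1)])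
    also have "\<dots> \<le> 2 * (norm (g 0))\<^sup>2 + 2 * ((1 - x\<^sup>2) ^ k * (norm (g x - g 0))\<^sup>2)"
      using mult_right_mono[OF w(2), of "2 * (norm (g 0))\<^sup>2"] by simp
    finally have "ennreal ((1 - x\<^sup>2) ^ k * (norm (g x))\<^sup>2) \<le>
       ennreal (2 * (norm (g 0))\<^sup>2 + 2 * ((1 - x\<^sup>2) ^ k * (norm (g x - g 0))\<^sup>2))"
      by (rule ennreal_leI)
    also have "\<dots> = ennreal (2 * (norm (g 0))\<^sup>2) + 2 * (?w x * ennreal ((norm (g x - g 0))\<^sup>2))"
      using w(1) by (simp add: ennreal_mult ennreal_plus)
    also have "\<dots> \<le> ennreal (2 * (norm (g 0))\<^sup>2) + 2 * (?w x * (2 * ?J x))"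
      unfolding M_def
      by (intro add_left_mono mult_left_mono square_abs_continuous_increment_le ac meas[unfolded M_def])
        (use x1 in auto)
    also have "2 * (?w x * (2 * ?J x)) = 4 * (?w x * ?J x)"
      by (simp add: mult.left_commute flip: mult.assoc)
    finally show "ennreal ((1 - x\<^sup>2) ^ k * (norm (g x))\<^sup>2) \<le>
       ennreal (2 * (norm (g 0))\<^sup>2) + 4 * (?w x * ?J x)" .
  qed
  also have "\<dots> = (\<integral>\<^sup>+x. ennreal (2 * (norm (g 0))\<^sup>2) \<partial>M) + 4 * (\<integral>\<^sup>+x. ?w x * ?J x \<partial>M)"
  proof -
    have "?J \<in> borel_measurable M"
      using measurable_segment_indicator[OF h[unfolded M_def]] unfolding M_def[symmetric]
      by (rule borel_measurable_nn_integral)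
    then have "(\<lambda>x. ?w x * ?J x) \<in> borel_measurable M" by measurable
    then show ?thesis by (simp add: nn_integral_add nn_integral_cmult)
  qed
  also have "\<dots> \<le> (\<integral>\<^sup>+x. ennreal (2 * (norm (g 0))\<^sup>2) \<partial>M) +
      4 * (2 * (\<integral>\<^sup>+t. ennreal ((1 - t\<^sup>2) ^ Suc k) * ?h t \<partial>M))"
    unfolding M_def by (intro add_left_mono mult_left_mono hardy_weighted_fubini h[unfolded M_def]) simp
  also have "(\<integral>\<^sup>+t. ennreal ((1 - t\<^sup>2) ^ Suc k) * ?h t \<partial>M) =
      (\<integral>\<^sup>+t. ennreal ((1 - t\<^sup>2) ^ Suc k * (norm (vector_derivative g (at t)))\<^sup>2) \<partial>M)"
    using mult_weight_le(1)[OF order_refl, of _ "Suc k"]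
    by (intro nn_integral_cong ennreal_mult[symmetric]) (auto simp: space)
  also have "(\<integral>\<^sup>+x. ennreal (2 * (norm (g 0))\<^sup>2) \<partial>M) + 4 * (2 * \<dots>) < \<infinity>"
    using fin by (auto simp: ennreal_mult_less_top less_top emeasure_eq_measure)
  finally show ?thesis .
qed

section \<open>Descent through the orders of derivatives\<close>

lemma square_weighted_deriv:
  assumes "x \<in> {-1<..<1}"
  shows "(cmod (weighted_deriv j f x))\<^sup>2 = (1 - x\<^sup>2) ^ j * (cmod (nth_deriv j f x))\<^sup>2"
proof -
  have "0 < 1 - x\<^sup>2" using assms abs_square_less_1[of x] by (auto simp: abs_less_iff)
  then have "((1 - x\<^sup>2) powr (real j / 2))\<^sup>2 = (1 - x\<^sup>2) ^ j"
    by (simp add: power2_eq_square powr_realpow flip: powr_add)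
  then show ?thesis
    by (simp add: weighted_deriv_def norm_mult power_mult_distrib)
qed

text \<open>
  Since the weight does not vanish on \<open>(-1,1)\<close>, dividing by it recovers the measurability of the
  derivative itself, which the exchange of integrals in the Hardy inequality relies on.
\<close>

lemma square_integrable_weighted_deriv_iff:
  defines "M \<equiv> lebesgue_on {-1<..<1::real}"
  shows "square_integrable_on (weighted_deriv j f) {-1<..<1} \<longleftrightarrow>
    nth_deriv j f \<in> borel_measurable M \<and>
    (\<integral>\<^sup>+x. ennreal ((1 - x\<^sup>2) ^ j * (cmod (nth_deriv j f x))\<^sup>2) \<partial>M) < \<infinity>"
proof -
  have space: "space M = {-1<..<1}" by (simp add: M_def space_restrict_space)
  have id[measurable]: "(\<lambda>x. x) \<in> borel_measurable M"
    unfolding M_def by (rule measurable_ident_lebesgue_on) simp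
  let ?p = "\<lambda>x. complex_of_real ((1 - x\<^sup>2) powr (real j / 2))"
  have p[measurable]: "?p \<in> borel_measurable M" by measurable
  have meas: "weighted_deriv j f \<in> borel_measurable M \<longleftrightarrow> nth_deriv j f \<in> borel_measurable M"
  proof
    assume [measurable]: "weighted_deriv j f \<in> borel_measurable M"
    have "(\<lambda>x. weighted_deriv j f x / ?p x) \<in> borel_measurable M" by measurable
    moreover have "weighted_deriv j f x / ?p x = nth_deriv j f x" if "x \<in> space M" for x
    proof -
      have "x\<^sup>2 \<noteq> 1" using that space abs_square_less_1[of x] by (auto simp: abs_less_iff)
      then show ?thesis by (simp add: weighted_deriv_def)
    qed
    ultimately show "nth_deriv j f \<in> borel_measurable M" by (simp cong: measurable_cong)
  next
    assume [measurable]: "nth_deriv j f \<in> borel_measurable M"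
    show "weighted_deriv j f \<in> borel_measurable M" unfolding weighted_deriv_def[abs_def] by measurable
  qed
  have "(\<integral>\<^sup>+x. ennreal (norm ((cmod (weighted_deriv j f x))\<^sup>2)) \<partial>M) =
     (\<integral>\<^sup>+x. ennreal ((1 - x\<^sup>2) ^ j * (cmod (nth_deriv j f x))\<^sup>2) \<partial>M)"
    by (intro nn_integral_cong) (simp add: space flip: square_weighted_deriv)
  then show ?thesis
    unfolding square_integrable_on_def M_def[symmetric] meas integrable_iff_bounded
    using meas by auto
qed

text \<open>
  The descent by one order. Every derivative of order at most \<open>m\<close> is locally absolutely continuous, so
  the Hardy step applies to it; this covers the top order \<open>j = m\<close> as well, where the next derivative
  exists only almost everywhere.
\<close>

lemma square_integrable_weighted_deriv_Suc:
  assumes "f \<in> AC_loc m (-1) 1" "j \<le> m"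
    "square_integrable_on (weighted_deriv (Suc j) f) {-1<..<1}"
  shows "square_integrable_on (weighted_deriv j f) {-1<..<1}"
proof -
  let ?g = "nth_deriv j f"
  have ac: "abs_continuous_on_Icc ?g c d" if "-1 < c" "c \<le> d" "d < 1" for c d
    using assms(1,2) that by (auto simp: AC_loc_def)
  have Suc: "nth_deriv (Suc j) f = (\<lambda>t. vector_derivative ?g (at t))"
    by (simp add: nth_deriv_def)
  have "isCont ?g x" if x: "x \<in> {-1<..<1}" for x
  proof -
    let ?c = "(x - 1) / 2" and ?d = "(x + 1) / 2"
    have "continuous_on {?c..?d} ?g"
      by (rule abs_continuous_on_Icc_continuous_on[OF ac]) (use x in auto)
    then show ?thesis by (rule continuous_on_interior) (use x in auto)
  qed
  then have "continuous_on {-1<..<1} ?g" by (simp add: continuous_on_eq_continuous_at)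
  then have "?g \<in> borel_measurable (lebesgue_on {-1<..<1})"
    by (rule continuous_imp_measurable_on_sets_lebesgue) simp
  moreover have "(\<integral>\<^sup>+x. ennreal ((1 - x\<^sup>2) ^ j * (cmod (?g x))\<^sup>2) \<partial>lebesgue_on {-1<..<1}) < \<infinity>"
  proof (rule weighted_hardy_step[OF ac])
    show "(\<lambda>t. vector_derivative ?g (at t)) \<in> borel_measurable (lebesgue_on {-1<..<1})"
      "(\<integral>\<^sup>+t. ennreal ((1 - t\<^sup>2) ^ Suc j * (cmod (vector_derivative ?g (at t)))\<^sup>2) \<partial>lebesgue_on {-1<..<1}) < \<infinity>"
      using assms(3) by (simp_all only: square_integrable_weighted_deriv_iff Suc)
  qed
  ultimately show ?thesis by (simp add: square_integrable_weighted_deriv_iff)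
qed

theorem theorem9p1:
  fixes n :: nat
  assumes "n \<ge> 1"
  shows "V n = V' n"
proof
  show "V n \<subseteq> V' n" by (auto simp: V_def V'_def)
  show "V' n \<subseteq> V n"
  proof
    fix f assume "f \<in> V' n"
    then have f: "f \<in> AC_loc (n - 1) (-1) 1"
      and top: "square_integrable_on (weighted_deriv n f) {-1<..<1}" by (auto simp: V'_def)
    have "square_integrable_on (weighted_deriv j f) {-1<..<1}" if "j \<le> n" for j
      using that
    proof (induction j rule: inc_induct)
      case (step j)
      show ?case by (rule square_integrable_weighted_deriv_Suc[OF f]) (use step in auto)
    qed (rule top)
    then show "f \<in> V n" using f by (simp add: V_def)
  qed
qed

end
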